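(* The Dehn invariant map $D:\widetilde{\mathcal{P}}(S^3)\to\widetilde{\mathcal{P}}(S^1)\otimes\widetilde{\mathcal{P}}(S^1)$ is not co-commutative; that is, $\tau\circ D\neq D$, where $\tau$ is the symmetry isomorphism $x\otimes y\mapsto y\otimes x$.
   Context: For a real inner product space $V$ of dimension $n$, $\mathrm{Pt}(V)$ is the abelian group generated by nondegenerate geodesic simplices $[v_1,\dots,v_n]$ in the unit sphere $S(V)$ (order of vertices irrelevant; vectors of non-unit length are rescaled to unit length), modulo $[P]=\sum_i[P_i]$ whenever a simplex $P$ is covered by finitely many simplices $P_i$ with disjoint interiors. $\widetilde{\mathrm{Pt}}(V)$ is the quotient of $\mathrm{Pt}(V)$ by all elements $[v_1,\dots,v_{n-1},v]+[v_1,\dots,v_{n-1},-v]$, where $v_1,\dots,v_{n-1}$ span a hyperplane and $v$ is a unit vector orthogonal to it. $\widetilde{\mathcal{P}}(S^{n-1})=\widetilde{\mathrm{Pt}}(\mathbb{R}^n)_{O(n)}$ (coinvariants for the action on vertices). The Dehn invariant map $D$ is the component of the Sah algebra coproduct induced on coinvariants by $$[v_1,\dots,v_4]\mapsto\sum_{S\subseteq\{v_1,\dots,v_4\},\,|S|=2}[S]\otimes[\mathrm{pr}_{\mathbb{R}^4\ominus\langle S\rangle}S^c],$$ where $\langle S\rangle$ is the span of $S$, $S^c$ is the complement of $S$ in $\{v_1,\dots,v_4\}$, $\mathbb{R}^4\ominus\langle S\rangle$ is the orthogonal complement, $\mathrm{pr}$ is orthogonal projection, and the two-dimensional inner product spaces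 $\langle S\rangle$ and $\mathbb{R}^4\ominus\langle S\rangle$ are identified with $\mathbb{R}^2$ by arbitrary isometries. Tensor products are over $\mathbb{Z}$. *)

theory Defs
  imports "HOL-Analysis.Analysis" "HOL-Algebra.Free_Abelian_Groups"
begin

text \<open>Abelian groups are HOL-Algebra groups, hence written multiplicatively; the free abelian
  groups \<open>free_Abelian_group X\<close> consist of finitely supported functions \<open>X \<Rightarrow>\<^sub>0 int\<close>.\<close>

section \<open>Tensor products and coinvariants of abelian groups\<close>

definition bilinear_relations ::
    "('g, 'm) monoid_scheme \<Rightarrow> ('h, 'n) monoid_scheme \<Rightarrow> ('g \<times> 'h \<Rightarrow>\<^sub>0 int) set" where
  "bilinear_relations G H =
     {frag_of (x \<otimes>\<^bsub>G\<^esub> x', y) - frag_of (x, y) - frag_of (x', y) | x x' y.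
        x \<in> carrier G \<and> x' \<in> carrier G \<and> y \<in> carrier H} \<union>
     {frag_of (x, y \<otimes>\<^bsub>H\<^esub> y') - frag_of (x, y) - frag_of (x, y') | x y y'.
        x \<in> carrier G \<and> y \<in> carrier H \<and> y' \<in> carrier H}"

definition bilinear_subgroup ::
    "('g, 'm) monoid_scheme \<Rightarrow> ('h, 'n) monoid_scheme \<Rightarrow> ('g \<times> 'h \<Rightarrow>\<^sub>0 int) set" where
  "bilinear_subgroup G H =
     generate (free_Abelian_group (carrier G \<times> carrier H)) (bilinear_relations G H)"

definition tensor_product ::
    "('g, 'm) monoid_scheme \<Rightarrow> ('h, 'n) monoid_scheme \<Rightarrow> ('g \<times> 'h \<Rightarrow>\<^sub>0 int) set monoid" where
  "tensor_product G H = free_Abelian_group (carrier G \<times> carrier H) Mod bilinear_subgroup G H"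

definition pure_tensor ::
    "('g, 'm) monoid_scheme \<Rightarrow> ('h, 'n) monoid_scheme \<Rightarrow> 'g \<Rightarrow> 'h \<Rightarrow> ('g \<times> 'h \<Rightarrow>\<^sub>0 int) set" where
  "pure_tensor G H x y =
     bilinear_subgroup G H #>\<^bsub>free_Abelian_group (carrier G \<times> carrier H)\<^esub> frag_of (x, y)"

text \<open>The swap of factors carries \<open>bilinear_subgroup G H\<close> onto \<open>bilinear_subgroup H G\<close>, so
  the map it induces on the quotients sends a coset to its image.  See \<open>tensor_swap_pure\<close> and
  \<open>tensor_swap_hom\<close> below.\<close>

definition tensor_swap :: "('g \<times> 'h \<Rightarrow>\<^sub>0 int) set \<Rightarrow> ('h \<times> 'g \<Rightarrow>\<^sub>0 int) set" where
  "tensor_swap X = frag_extend (frag_of \<circ> prod.swap) ` X"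

text \<open>Here \<open>A\<close> is a set of endomorphisms of the abelian group \<open>G\<close>, namely the image of the
  acting group.\<close>

definition coinvariant_subgroup :: "('g, 'm) monoid_scheme \<Rightarrow> ('g \<Rightarrow> 'g) set \<Rightarrow> 'g set" where
  "coinvariant_subgroup G A = generate G {\<alpha> x \<otimes>\<^bsub>G\<^esub> inv\<^bsub>G\<^esub> x | \<alpha> x. \<alpha> \<in> A \<and> x \<in> carrier G}"

definition coinvariants :: "('g, 'm) monoid_scheme \<Rightarrow> ('g \<Rightarrow> 'g) set \<Rightarrow> 'g set monoid" where
  "coinvariants G A = G Mod coinvariant_subgroup G A"


section \<open>Spherical scissors congruence groups\<close>

text \<open>A nondegenerate geodesic simplex is represented by its vertex set.\<close>

definition simplices :: "'a::euclidean_space set set" where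
  "simplices = {B. B \<subseteq> sphere 0 1 \<and> independent B \<and> card B = DIM('a)}"

definition geodesic_simplex :: "'a::euclidean_space set \<Rightarrow> 'a set" where
  "geodesic_simplex B = sphere 0 1 \<inter> convex_cone hull B"

text \<open>Interiors are taken in the unit sphere.\<close>

definition subdivides :: "'a::euclidean_space set set \<Rightarrow> 'a set \<Rightarrow> bool" where
  "subdivides \<Q> P \<longleftrightarrow> finite \<Q> \<and> \<Q> \<subseteq> simplices \<and> P \<in> simplices \<and>
     geodesic_simplex P = (\<Union>Q\<in>\<Q>. geodesic_simplex Q) \<and>
     pairwise (\<lambda>Q Q'. disjnt (top_of_set (sphere 0 1) interior_of geodesic_simplex Q)
                             (top_of_set (sphere 0 1) interior_of geodesic_simplex Q')) \<Q>"

definition subdivision_subgroup :: "('a::euclidean_space set \<Rightarrow>\<^sub>0 int) set" where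
  "subdivision_subgroup =
     generate (free_Abelian_group simplices)
       {frag_of P - (\<Sum>Q\<in>\<Q>. frag_of Q) | P \<Q>. subdivides \<Q> P}"

definition Pt :: "('a::euclidean_space set \<Rightarrow>\<^sub>0 int) set monoid" where
  "Pt = free_Abelian_group simplices Mod subdivision_subgroup"

definition Pt_class :: "'a::euclidean_space set \<Rightarrow> ('a set \<Rightarrow>\<^sub>0 int) set" where
  "Pt_class B = subdivision_subgroup #>\<^bsub>free_Abelian_group simplices\<^esub> frag_of B"

definition suspension_subgroup :: "('a::euclidean_space set \<Rightarrow>\<^sub>0 int) set set" where
  "suspension_subgroup =
     generate Pt
       {Pt_class (insert v B) \<otimes>\<^bsub>Pt\<^esub> Pt_class (insert (- v) B) | v B.
          B \<subseteq> sphere 0 1 \<and> independent B \<and> Suc (card B) = DIM('a) \<and>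
          norm v = 1 \<and> v \<in> (span B)\<^sup>\<bottom>}"

definition red_Pt :: "('a::euclidean_space set \<Rightarrow>\<^sub>0 int) set set monoid" where
  "red_Pt = Pt Mod suspension_subgroup"

definition red_Pt_class :: "'a::euclidean_space set \<Rightarrow> ('a set \<Rightarrow>\<^sub>0 int) set set" where
  "red_Pt_class B = suspension_subgroup #>\<^bsub>Pt\<^esub> Pt_class B"

text \<open>An orthogonal map \<open>g\<close> acts on chains by moving vertices.  It preserves the subgroups
  divided out above, so the induced action on a coset (of cosets) is given by taking images.
  See \<open>red_Pt_action_class\<close> and \<open>red_Pt_action_hom\<close> below.\<close>

definition chain_action ::
    "('a::euclidean_space \<Rightarrow> 'a) \<Rightarrow> ('a set \<Rightarrow>\<^sub>0 int) \<Rightarrow> ('a set \<Rightarrow>\<^sub>0 int)" where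
  "chain_action g = frag_extend (\<lambda>B. frag_of (g ` B))"

definition red_Pt_action ::
    "('a::euclidean_space \<Rightarrow> 'a) \<Rightarrow> ('a set \<Rightarrow>\<^sub>0 int) set set \<Rightarrow> ('a set \<Rightarrow>\<^sub>0 int) set set" where
  "red_Pt_action g X = (\<lambda>Y. chain_action g ` Y) ` X"

type_synonym 'a scissors_class = "('a set \<Rightarrow>\<^sub>0 int) set set set"

text \<open>The group $\widetilde{\mathcal P}(S^{n-1})$ is \<open>scissors_group\<close> at the type \<open>real ^ 'n\<close>
  with \<open>n = CARD('n)\<close>.\<close>

definition scissors_group :: "'a::euclidean_space scissors_class monoid" where
  "scissors_group = coinvariants red_Pt (red_Pt_action ` {g. orthogonal_transformation g})"

definition simplex_class :: "'a::euclidean_space set \<Rightarrow> 'a scissors_class" where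
  "simplex_class B =
     coinvariant_subgroup red_Pt (red_Pt_action ` {g. orthogonal_transformation g})
       #>\<^bsub>red_Pt\<^esub> red_Pt_class B"


section \<open>The Dehn invariant\<close>

definition orth_proj :: "'a::euclidean_space set \<Rightarrow> 'a \<Rightarrow> 'a" where
  "orth_proj W x = (THE y. y \<in> W \<and> x - y \<in> W\<^sup>\<bottom>)"

definition plane_isometry :: "'a::euclidean_space set \<Rightarrow> ('a \<Rightarrow> real ^ 2) \<Rightarrow> bool" where
  "plane_isometry W f \<longleftrightarrow> linear f \<and> (\<forall>x\<in>W. norm (f x) = norm x) \<and> f ` W = UNIV"

text \<open>The class of the arc with vertices the normalized elements of \<open>S\<close>, where \<open>S\<close> consists of
  two independent vectors.  It does not depend on the chosen isometry, because two choices differ by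
  an element of the orthogonal group of the plane.  See \<open>arc_class_eq\<close> below.\<close>

definition arc_class :: "'a::euclidean_space set \<Rightarrow> (real ^ 2) scissors_class" where
  "arc_class S = simplex_class ((SOME f. plane_isometry (span S) f) ` sgn ` S)"

abbreviation scissors_S1_tensor_S1 ::
    "((real ^ 2) scissors_class \<times> (real ^ 2) scissors_class \<Rightarrow>\<^sub>0 int) set monoid" where
  "scissors_S1_tensor_S1 \<equiv> tensor_product scissors_group scissors_group"

text \<open>The classes of simplices generate the scissors group, so at most one homomorphism on its
  carrier has the prescribed values.  See \<open>is_Dehn_invariant_unique\<close> below.\<close>

definition is_Dehn_invariant ::
    "((real ^ 4) scissors_class \<Rightarrow>
      ((real ^ 2) scissors_class \<times> (real ^ 2) scissors_class \<Rightarrow>\<^sub>0 int) set) \<Rightarrow> bool" where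
  "is_Dehn_invariant D \<longleftrightarrow>
     D \<in> hom scissors_group scissors_S1_tensor_S1 \<and>
     (\<forall>B\<in>simplices. D (simplex_class B) =
        (\<Otimes>\<^bsub>scissors_S1_tensor_S1\<^esub>S\<in>{S. S \<subseteq> B \<and> card S = 2}.
            pure_tensor scissors_group scissors_group
              (arc_class S) (arc_class (orth_proj ((span S)\<^sup>\<bottom>) ` (B - S)))))"


section \<open>Consistency of the definitions\<close>

lemma image_r_coset:
  assumes "h \<in> hom G K" "H \<subseteq> carrier G" "x \<in> carrier G"
  shows "h ` (H #>\<^bsub>G\<^esub> x) = h ` H #>\<^bsub>K\<^esub> h x"
proof -
  have "h (a \<otimes>\<^bsub>G\<^esub> x) = h a \<otimes>\<^bsub>K\<^esub> h x" if "a \<in> H" for a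
    using assms that by (auto simp: hom_mult)
  then show ?thesis by (force simp: r_coset_def)
qed

lemma image_hom_Mod:
  assumes G: "comm_group G" and K: "comm_group K" and h: "h \<in> hom G K"
    and H: "subgroup H G" and N: "subgroup N K" and img: "h ` H = N"
  shows "(\<lambda>Y. h ` Y) \<in> hom (G Mod H) (K Mod N)"
proof -
  interpret G: comm_group G by fact
  interpret K: comm_group K by fact
  interpret nH: normal H G using H by (simp add: G.normal_iff_subgroup)
  interpret nN: normal N K using N by (simp add: K.normal_iff_subgroup)
  have im: "h ` (H #>\<^bsub>G\<^esub> x) = N #>\<^bsub>K\<^esub> h x" if "x \<in> carrier G" for x
    using image_r_coset[OF h nH.subset that] img by simp
  have hx: "h x \<in> carrier K" if "x \<in> carrier G" for x
    using h that by (rule hom_in_carrier)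
  show ?thesis
  proof (rule homI)
    fix X assume "X \<in> carrier (G Mod H)"
    then show "h ` X \<in> carrier (K Mod N)"
      using im hx by (auto simp: carrier_FactGroup)
  next
    fix X Y assume "X \<in> carrier (G Mod H)" "Y \<in> carrier (G Mod H)"
    then obtain x y where x: "x \<in> carrier G" "X = H #>\<^bsub>G\<^esub> x" and y: "y \<in> carrier G" "Y = H #>\<^bsub>G\<^esub> y"
      by (auto simp: carrier_FactGroup)
    then show "h ` (X \<otimes>\<^bsub>G Mod H\<^esub> Y) = h ` X \<otimes>\<^bsub>K Mod N\<^esub> h ` Y"
      using h by (simp add: nH.rcos_sum nN.rcos_sum im hx hom_mult)
  qed
qed

lemma image_generate:
  assumes "group G" "group K" "h \<in> hom G K" "X \<subseteq> carrier G"
  shows "h ` generate G X = generate K (h ` X)"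
  using group_hom.generate_img[of G K h X] assms
  by (simp add: group_hom_def group_hom_axioms_def)

lemma r_coset_cong:
  assumes "comm_group G" "subgroup H G" "x \<in> carrier G" "y \<in> carrier G"
    "y \<otimes>\<^bsub>G\<^esub> inv\<^bsub>G\<^esub> x \<in> H"
  shows "H #>\<^bsub>G\<^esub> y = H #>\<^bsub>G\<^esub> x"
proof -
  interpret comm_group G by fact
  have "y \<in> H #>\<^bsub>G\<^esub> x"
    using assms by (auto simp: r_coset_def inv_solve_right m_assoc intro!: bexI[of _ "y \<otimes>\<^bsub>G\<^esub> inv\<^bsub>G\<^esub> x"])
  then show ?thesis using repr_independence[OF _ assms(3,2)] by simp
qed

lemma frag_extend_hom:
  assumes "\<And>s. s \<in> S \<Longrightarrow> Poly_Mapping.keys (f s) \<subseteq> T"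
  shows "frag_extend f \<in> hom (free_Abelian_group S) (free_Abelian_group T)"
proof (rule homI)
  fix x assume "x \<in> carrier (free_Abelian_group S)"
  then show "frag_extend f x \<in> carrier (free_Abelian_group T)"
    using keys_frag_extend[of f x] assms by fastforce
qed (simp add: frag_extend_add)

subsection \<open>Tensor products\<close>

lemma bilinear_relations_subset:
  assumes "comm_group G" "comm_group H"
  shows "bilinear_relations G H \<subseteq> carrier (free_Abelian_group (carrier G \<times> carrier H))"
proof -
  interpret G: comm_group G by fact
  interpret H: comm_group H by fact
  show ?thesis
  proof
    fix r assume "r \<in> bilinear_relations G H"
    then obtain p q s where "r = frag_of p - frag_of q - frag_of s"
      "p \<in> carrier G \<times> carrier H" "q \<in> carrier G \<times> carrier H" "s \<in> carrier G \<times> carrier H"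
      unfolding bilinear_relations_def by blast
    moreover have "Poly_Mapping.keys (frag_of p - frag_of q - frag_of s) \<subseteq> {p, q, s}"
      using keys_diff[of "frag_of p - frag_of q" "frag_of s"] keys_diff[of "frag_of p" "frag_of q"] by auto
    ultimately show "r \<in> carrier (free_Abelian_group (carrier G \<times> carrier H))" by auto
  qed
qed

lemma subgroup_bilinear:
  assumes "comm_group G" "comm_group H"
  shows "subgroup (bilinear_subgroup G H) (free_Abelian_group (carrier G \<times> carrier H))"
  unfolding bilinear_subgroup_def
  by (intro group.generate_is_subgroup bilinear_relations_subset assms) auto

lemma comm_group_tensor_product:
  assumes "comm_group G" "comm_group H"
  shows "comm_group (tensor_product G H)"
  unfolding tensor_product_def
  by (intro comm_group.abelian_FactGroup abelian_free_Abelian_group subgroup_bilinear assms)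

lemma pure_tensor_closed:
  assumes "x \<in> carrier G" "y \<in> carrier H"
  shows "pure_tensor G H x y \<in> carrier (tensor_product G H)"
  using assms by (force simp: pure_tensor_def tensor_product_def carrier_FactGroup)

lemma swap_hom:
  "frag_extend (frag_of \<circ> prod.swap) \<in>
     hom (free_Abelian_group (A \<times> B)) (free_Abelian_group (B \<times> A))"
  by (rule frag_extend_hom) auto

lemma swap_bilinear_subgroup:
  assumes "comm_group G" "comm_group H"
  shows "frag_extend (frag_of \<circ> prod.swap) ` bilinear_subgroup G H = bilinear_subgroup H G"
proof -
  have "frag_extend (frag_of \<circ> prod.swap) ` bilinear_relations G H = bilinear_relations H G"
    unfolding bilinear_relations_def image_Un
    by (subst Un_commute, rule arg_cong2[where f = "(\<union>)"]; 
        force simp: frag_extend_diff image_iff set_eq_iff)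
  then show ?thesis
    unfolding bilinear_subgroup_def
    by (subst image_generate[OF _ _ swap_hom bilinear_relations_subset[OF assms]]) auto
qed

lemma tensor_swap_pure:
  assumes "comm_group G" "comm_group H" "x \<in> carrier G" "y \<in> carrier H"
  shows "tensor_swap (pure_tensor G H x y) = pure_tensor H G y x"
  unfolding tensor_swap_def pure_tensor_def
  by (subst image_r_coset[OF swap_hom])
     (use assms subgroup.subset[OF subgroup_bilinear[OF assms(1,2)]] in
       \<open>simp_all add: swap_bilinear_subgroup\<close>)

lemma tensor_swap_hom:
  assumes "comm_group G" "comm_group H"
  shows "tensor_swap \<in> hom (tensor_product G H) (tensor_product H G)"
  using image_hom_Mod[OF abelian_free_Abelian_group abelian_free_Abelian_group swap_hom
      subgroup_bilinear[OF assms] subgroup_bilinear[OF assms(2,1)] swap_bilinear_subgroup[OF assms]]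
  by (simp add: tensor_product_def tensor_swap_def[abs_def])

subsection \<open>The scissors groups\<close>

lemma subdivision_relations_subset:
  "{frag_of P - (\<Sum>Q\<in>\<Q>. frag_of Q) | P \<Q>. subdivides \<Q> P} \<subseteq> carrier (free_Abelian_group simplices)"
proof clarify
  fix P :: "'a set" and \<Q> assume "subdivides \<Q> P"
  then have "frag_of P \<in> carrier (free_Abelian_group simplices)"
    and "(\<Sum>Q\<in>\<Q>. frag_of Q) \<in> carrier (free_Abelian_group simplices)"
    by (auto simp: subdivides_def subset_iff simp del: carrier_free_Abelian_group_iff
        intro!: sum_closed_free_Abelian_group)
  then show "frag_of P - (\<Sum>Q\<in>\<Q>. frag_of Q) \<in> carrier (free_Abelian_group simplices)"
    using keys_diff[of "frag_of P" "\<Sum>Q\<in>\<Q>. frag_of Q"] by auto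
qed

lemma subgroup_subdivision: "subgroup subdivision_subgroup (free_Abelian_group simplices)"
  unfolding subdivision_subgroup_def
  by (intro group.generate_is_subgroup subdivision_relations_subset) auto

lemma comm_group_Pt: "comm_group Pt"
  unfolding Pt_def
  by (intro comm_group.abelian_FactGroup abelian_free_Abelian_group subgroup_subdivision)

lemma Pt_class_closed: "B \<in> simplices \<Longrightarrow> Pt_class B \<in> carrier Pt"
  by (auto simp: Pt_def Pt_class_def carrier_FactGroup)

lemma insert_in_simplices:
  fixes v :: "'a::euclidean_space"
  assumes "B \<subseteq> sphere 0 1" "independent B" "Suc (card B) = DIM('a)" "norm v = 1" "v \<in> (span B)\<^sup>\<bottom>"
  shows "insert v B \<in> simplices"
proof -
  have "v \<notin> span B"
    using assms(4,5) by (auto simp: orthogonal_comp_def orthogonal_def)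
  moreover from this have "v \<notin> B" using span_base by auto
  moreover have "finite B" using assms(2) independent_imp_finite by auto
  ultimately show ?thesis
    using assms by (auto simp: simplices_def independent_insert)
qed

lemma suspension_relations_subset:
  "{Pt_class (insert v B) \<otimes>\<^bsub>Pt\<^esub> Pt_class (insert (- v) B) | v (B :: 'a::euclidean_space set).
      B \<subseteq> sphere 0 1 \<and> independent B \<and> Suc (card B) = DIM('a) \<and> norm v = 1 \<and> v \<in> (span B)\<^sup>\<bottom>}
   \<subseteq> carrier Pt"
proof clarify
  fix v :: 'a and B
  assume *: "B \<subseteq> sphere 0 1" "independent B" "Suc (card B) = DIM('a)" "norm v = 1" "v \<in> (span B)\<^sup>\<bottom>"
  have "- v \<in> (span B)\<^sup>\<bottom>"
    using * by (simp add: subspace_neg subspace_orthogonal_comp)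
  then have "insert v B \<in> simplices" "insert (- v) B \<in> simplices"
    using * by (auto intro: insert_in_simplices)
  then show "Pt_class (insert v B) \<otimes>\<^bsub>Pt\<^esub> Pt_class (insert (- v) B) \<in> carrier Pt"
    by (intro monoid.m_closed Pt_class_closed comm_group.axioms group.axioms comm_group_Pt)
       (auto intro: group.is_monoid comm_group.axioms(2) comm_group_Pt)
qed

lemma group_Pt: "group Pt"
  using comm_group_Pt by (rule comm_group.axioms(2))

lemma subgroup_suspension: "subgroup suspension_subgroup Pt"
  unfolding suspension_subgroup_def
  by (intro group.generate_is_subgroup suspension_relations_subset group_Pt)

lemma comm_group_red_Pt: "comm_group red_Pt"
  unfolding red_Pt_def
  by (intro comm_group.abelian_FactGroup comm_group_Pt subgroup_suspension)

lemma group_red_Pt: "group red_Pt"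
  using comm_group_red_Pt by (rule comm_group.axioms(2))

lemma red_Pt_class_closed: "B \<in> simplices \<Longrightarrow> red_Pt_class B \<in> carrier red_Pt"
  by (auto simp: red_Pt_def red_Pt_class_def carrier_FactGroup Pt_class_closed)

subsection \<open>The orthogonal action\<close>

context
  fixes g :: "'a::euclidean_space \<Rightarrow> 'a"
  assumes g: "orthogonal_transformation g"
begin

lemma orth_lin: "linear g" and orth_bij: "bij g" and orth_norm: "norm (g x) = norm x"
  using g by (auto simp: orthogonal_transformation_linear orthogonal_transformation_bij
      orthogonal_transformation_norm)

lemma orth_inj: "inj_on g A"
  using orth_bij by (meson bij_def inj_on_subset subset_UNIV)

lemma orth_sphere: "g ` sphere 0 1 = sphere 0 1"
proof -
  have "x \<in> g ` sphere 0 1" if "norm x = 1" for x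
  proof -
    obtain y where "x = g y" using orth_bij by (metis bij_pointE)
    then show ?thesis using that orth_norm by auto
  qed
  then show ?thesis using orth_norm by auto
qed

lemma orth_independent: "independent B \<Longrightarrow> independent (g ` B)"
  using orth_lin orth_inj by (metis linear_independent_injective_image)

lemma image_in_simplices: "B \<in> simplices \<Longrightarrow> g ` B \<in> simplices"
  using orth_norm orth_independent by (auto simp: simplices_def card_image[OF orth_inj])

lemma geodesic_simplex_image: "geodesic_simplex (g ` B) = g ` geodesic_simplex B"
  unfolding geodesic_simplex_def
  by (simp add: convex_cone_hull_linear_image[OF orth_lin] image_Int[OF orth_inj] orth_sphere)

lemma interior_image:
  assumes "X \<subseteq> sphere 0 1"
  shows "top_of_set (sphere 0 1) interior_of (g ` X) = g ` (top_of_set (sphere 0 1) interior_of X)"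
proof -
  have inv: "linear (inv_into UNIV g)" "\<And>x. norm (inv_into UNIV g x) = norm x"
    using orthogonal_transformation_inv[OF g]
    by (auto simp: orthogonal_transformation_linear orthogonal_transformation_norm)
  have "homeomorphic_maps (top_of_set (sphere 0 1)) (top_of_set (sphere 0 1)) g (inv_into UNIV g)"
    using orth_lin orth_norm orth_bij inv
    by (auto simp: homeomorphic_maps_def linear_continuous_on linear_linear bij_def surj_f_inv_f)
  then show ?thesis
    using assms by (intro homeomorphic_map_interior_of) (auto simp: homeomorphic_map_maps)
qed

lemma subdivides_image:
  assumes "subdivides \<Q> P"
  shows "subdivides ((`) g ` \<Q>) (g ` P)"
proof -
  have geo: "geodesic_simplex Q \<subseteq> sphere 0 1" for Q :: "'a set"
    by (simp add: geodesic_simplex_def)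
  show ?thesis
    using assms orth_inj[of UNIV] unfolding subdivides_def
    by (force simp: geodesic_simplex_image image_in_simplices interior_image[OF geo] pairwise_def
        disjnt_def image_Int[OF orth_inj, symmetric])
qed

end

lemma chain_action_of: "chain_action g (frag_of B) = frag_of (g ` B)"
  by (simp add: chain_action_def)

lemma chain_action_hom:
  fixes g :: "'a::euclidean_space \<Rightarrow> 'a"
  assumes "orthogonal_transformation g"
  shows "chain_action g \<in> hom (free_Abelian_group simplices) (free_Abelian_group simplices)"
  unfolding chain_action_def by (rule frag_extend_hom) (use assms in \<open>simp add: image_in_simplices\<close>)

lemma chain_action_relation:
  fixes g :: "'a::euclidean_space \<Rightarrow> 'a"
  assumes "orthogonal_transformation g" "subdivides \<Q> P"
  shows "chain_action g (frag_of P - (\<Sum>Q\<in>\<Q>. frag_of Q)) =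
           frag_of (g ` P) - (\<Sum>Q\<in>(`) g ` \<Q>. frag_of Q)"
proof -
  have "inj_on ((`) g) \<Q>"
    using orth_inj[OF assms(1), of UNIV] by (meson inj_image_eq_iff inj_onI)
  moreover have "finite \<Q>" using assms by (simp add: subdivides_def)
  ultimately show ?thesis
    by (simp add: chain_action_def frag_extend_diff frag_extend_sum sum.reindex o_def)
qed

lemma image_inv_orth:
  fixes g :: "'a::euclidean_space \<Rightarrow> 'a"
  assumes "orthogonal_transformation g"
  shows "g ` (inv_into UNIV g ` X) = X" "inv_into UNIV g ` (g ` X) = X" "g (inv_into UNIV g x) = x" "inv_into UNIV g (g x) = x"
  using orthogonal_transformation_bij[OF assms]
  by (auto simp: bij_def image_image surj_f_inv_f)

lemma chain_action_subdivision:
  fixes g :: "'a::euclidean_space \<Rightarrow> 'a"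
  assumes g: "orthogonal_transformation g"
  shows "chain_action g ` subdivision_subgroup = subdivision_subgroup"
proof -
  let ?R = "{frag_of P - (\<Sum>Q\<in>\<Q>. frag_of Q) | P (\<Q> :: 'a set set). subdivides \<Q> P}"
  have "chain_action g ` ?R = ?R"
  proof (intro equalityI subsetI)
    fix y assume "y \<in> chain_action g ` ?R"
    then obtain P \<Q> where "subdivides \<Q> P" "y = chain_action g (frag_of P - (\<Sum>Q\<in>\<Q>. frag_of Q))"
      by auto
    then show "y \<in> ?R"
      using chain_action_relation[OF g] subdivides_image[OF g] by blast
  next
    fix y assume "y \<in> ?R"
    then obtain P \<Q> where *: "subdivides \<Q> P" "y = frag_of P - (\<Sum>Q\<in>\<Q>. frag_of Q)" by auto
    let ?g = "inv_into UNIV g"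
    have s: "subdivides ((`) ?g ` \<Q>) (?g ` P)"
      using * subdivides_image orthogonal_transformation_inv[OF g] by blast
    have "(`) g ` (`) ?g ` \<Q> = \<Q>"
      by (simp add: image_image image_inv_orth[OF g])
    then have "y = chain_action g (frag_of (?g ` P) - (\<Sum>Q\<in>(`) ?g ` \<Q>. frag_of Q))"
      using chain_action_relation[OF g s] * by (simp add: image_inv_orth(1)[OF g])
    then show "y \<in> chain_action g ` ?R" using s by blast
  qed
  then show ?thesis
    unfolding subdivision_subgroup_def
    by (subst image_generate[OF _ _ chain_action_hom[OF g] subdivision_relations_subset]) auto
qed

lemma Pt_action_hom:
  fixes g :: "'a::euclidean_space \<Rightarrow> 'a"
  assumes g: "orthogonal_transformation g"
  shows "(\<lambda>Y. chain_action g ` Y) \<in> hom Pt Pt"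
  unfolding Pt_def
  by (rule image_hom_Mod[OF abelian_free_Abelian_group abelian_free_Abelian_group
        chain_action_hom[OF g] subgroup_subdivision subgroup_subdivision
        chain_action_subdivision[OF g]])

lemma Pt_action_class:
  fixes g :: "'a::euclidean_space \<Rightarrow> 'a"
  assumes g: "orthogonal_transformation g" and B: "B \<in> simplices"
  shows "chain_action g ` Pt_class B = Pt_class (g ` B)"
  unfolding Pt_class_def
  by (subst image_r_coset[OF chain_action_hom[OF g] subgroup.subset[OF subgroup_subdivision]])
     (use B in \<open>simp_all add: chain_action_subdivision[OF g] chain_action_of\<close>)

abbreviation susp_cond :: "'a::euclidean_space \<Rightarrow> 'a set \<Rightarrow> bool" where
  "susp_cond v B \<equiv> B \<subseteq> sphere 0 1 \<and> independent B \<and> Suc (card B) = DIM('a) \<and>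
     norm v = 1 \<and> v \<in> (span B)\<^sup>\<bottom>"

lemma susp_cond_image:
  fixes g :: "'a::euclidean_space \<Rightarrow> 'a"
  assumes g: "orthogonal_transformation g" and "susp_cond v B"
  shows "susp_cond (g v) (g ` B)"
proof -
  have "g v \<in> (span (g ` B))\<^sup>\<bottom>"
    using assms(2) g
    by (auto simp: orthogonal_comp_def linear_span_image[OF orth_lin[OF g]]
        orthogonal_orthogonal_transformation)
  then show ?thesis
    using assms(2) orth_norm[OF g] orth_independent[OF g] card_image[OF orth_inj[OF g]] by auto
qed

lemma susp_cond_simplices:
  assumes "susp_cond v B"
  shows "insert v B \<in> simplices" "insert (- v) B \<in> simplices"
  using assms by (auto intro!: insert_in_simplices simp: subspace_neg subspace_orthogonal_comp)

lemma Pt_action_relation: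
  fixes g :: "'a::euclidean_space \<Rightarrow> 'a"
  assumes g: "orthogonal_transformation g" and s: "susp_cond v B"
  shows "chain_action g ` (Pt_class (insert v B) \<otimes>\<^bsub>Pt\<^esub> Pt_class (insert (- v) B)) =
     Pt_class (insert (g v) (g ` B)) \<otimes>\<^bsub>Pt\<^esub> Pt_class (insert (- g v) (g ` B))"
  using hom_mult[OF Pt_action_hom[OF g] Pt_class_closed Pt_class_closed] susp_cond_simplices[OF s]
  by (simp add: Pt_action_class[OF g] linear_neg[OF orth_lin[OF g]])

lemma Pt_action_suspension:
  fixes g :: "'a::euclidean_space \<Rightarrow> 'a"
  assumes g: "orthogonal_transformation g"
  shows "(\<lambda>Y. chain_action g ` Y) ` suspension_subgroup = suspension_subgroup"
proof -
  let ?R = "{Pt_class (insert v B) \<otimes>\<^bsub>Pt\<^esub> Pt_class (insert (- v) B) | v (B :: 'a set). susp_cond v B}"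
  have "(\<lambda>Y. chain_action g ` Y) ` ?R = ?R"
  proof (intro equalityI subsetI)
    fix y assume "y \<in> (\<lambda>Y. chain_action g ` Y) ` ?R"
    then obtain r where r: "r \<in> ?R" "y = chain_action g ` r" by (rule imageE)
    from r(1) obtain v B where s: "susp_cond v B"
      and "r = Pt_class (insert v B) \<otimes>\<^bsub>Pt\<^esub> Pt_class (insert (- v) B)"
      by (elim CollectE exE conjE) (rule that, auto)
    then have "y = Pt_class (insert (g v) (g ` B)) \<otimes>\<^bsub>Pt\<^esub> Pt_class (insert (- g v) (g ` B))"
      using r(2) Pt_action_relation[OF g s] by simp
    then show "y \<in> ?R"
      using susp_cond_image[OF g s] by (intro CollectI exI conjI) auto
  next
    fix y assume "y \<in> ?R"
    then obtain v B where *: "susp_cond v B"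
      "y = Pt_class (insert v B) \<otimes>\<^bsub>Pt\<^esub> Pt_class (insert (- v) B)"
      by (elim CollectE exE conjE) (rule that, auto)
    have s: "susp_cond (inv_into UNIV g v) (inv_into UNIV g ` B)"
      using *(1) by (rule susp_cond_image[OF orthogonal_transformation_inv[OF g]])
    let ?r = "Pt_class (insert (inv_into UNIV g v) (inv_into UNIV g ` B)) \<otimes>\<^bsub>Pt\<^esub>
                Pt_class (insert (- inv_into UNIV g v) (inv_into UNIV g ` B))"
    have "y = chain_action g ` ?r"
      using Pt_action_relation[OF g s] *(2) unfolding image_inv_orth[OF g] by simp
    moreover have "?r \<in> ?R"
      using s by (intro CollectI exI conjI) auto
    ultimately show "y \<in> (\<lambda>Y. chain_action g ` Y) ` ?R"
      by (rule image_eqI)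
  qed
  then show ?thesis
    unfolding suspension_subgroup_def
    by (subst image_generate[OF group_Pt group_Pt Pt_action_hom[OF g] suspension_relations_subset]) auto
qed

lemma red_Pt_action_hom:
  fixes g :: "'a::euclidean_space \<Rightarrow> 'a"
  assumes g: "orthogonal_transformation g"
  shows "red_Pt_action g \<in> hom red_Pt red_Pt"
  using image_hom_Mod[OF comm_group_Pt comm_group_Pt Pt_action_hom[OF g] subgroup_suspension
      subgroup_suspension Pt_action_suspension[OF g]]
  by (simp add: red_Pt_def red_Pt_action_def[abs_def])

lemma red_Pt_action_class:
  fixes g :: "'a::euclidean_space \<Rightarrow> 'a"
  assumes g: "orthogonal_transformation g" and B: "B \<in> simplices"
  shows "red_Pt_action g (red_Pt_class B) = red_Pt_class (g ` B)"
  unfolding red_Pt_action_def red_Pt_class_def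
  by (subst image_r_coset[OF Pt_action_hom[OF g] subgroup.subset[OF subgroup_suspension]])
     (use B in \<open>simp_all add: Pt_action_suspension[OF g] Pt_class_closed Pt_action_class[OF g]\<close>)

subsection \<open>Coinvariants\<close>

lemma subgroup_coinvariant:
  assumes "comm_group G" "A \<subseteq> hom G G"
  shows "subgroup (coinvariant_subgroup G A) G"
proof -
  interpret comm_group G by fact
  show ?thesis
    unfolding coinvariant_subgroup_def
    by (rule generate_is_subgroup) (use assms(2) in \<open>auto simp: subset_iff hom_in_carrier\<close>)
qed

abbreviation orth_actions :: "(('a::euclidean_space set \<Rightarrow>\<^sub>0 int) set set \<Rightarrow> ('a set \<Rightarrow>\<^sub>0 int) set set) set" where
  "orth_actions \<equiv> red_Pt_action ` {g. orthogonal_transformation g}"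

lemma orth_actions_hom: "orth_actions \<subseteq> hom red_Pt red_Pt"
  using red_Pt_action_hom by blast

lemma comm_group_scissors_group: "comm_group scissors_group"
  unfolding scissors_group_def coinvariants_def
  by (intro comm_group.abelian_FactGroup comm_group_red_Pt subgroup_coinvariant orth_actions_hom)

lemma simplex_class_closed: "B \<in> simplices \<Longrightarrow> simplex_class B \<in> carrier scissors_group"
  by (auto simp: scissors_group_def coinvariants_def simplex_class_def carrier_FactGroup
      red_Pt_class_closed)

lemma simplex_class_image:
  fixes g :: "'a::euclidean_space \<Rightarrow> 'a"
  assumes g: "orthogonal_transformation g" and B: "B \<in> simplices"
  shows "simplex_class (g ` B) = simplex_class B"
  unfolding simplex_class_def
proof (rule r_coset_cong)
  show "red_Pt_class (g ` B) \<otimes>\<^bsub>red_Pt\<^esub> inv\<^bsub>red_Pt\<^esub> red_Pt_class B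
          \<in> coinvariant_subgroup red_Pt orth_actions"
    unfolding coinvariant_subgroup_def red_Pt_action_class[OF g B, symmetric]
    using red_Pt_class_closed[OF B] g by (intro generate.incl) blast
qed (use g B in \<open>auto intro!: comm_group_red_Pt subgroup_coinvariant orth_actions_hom
      red_Pt_class_closed image_in_simplices\<close>)

lemma scissors_group_hom_eqI:
  fixes D D' :: "'a::euclidean_space scissors_class \<Rightarrow> 'b"
  assumes K: "group K" and D: "D \<in> hom scissors_group K" and D': "D' \<in> hom scissors_group K"
    and eq: "\<And>B. B \<in> simplices \<Longrightarrow> D (simplex_class B) = D' (simplex_class B)"
    and x: "x \<in> carrier scissors_group"
  shows "D x = D' x"
proof -
  let ?F = "free_Abelian_group (simplices :: 'a set set)"
  let ?S1 = "subdivision_subgroup :: ('a set \<Rightarrow>\<^sub>0 int) set"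
  let ?S2 = "suspension_subgroup :: ('a set \<Rightarrow>\<^sub>0 int) set set"
  let ?S3 = "coinvariant_subgroup red_Pt orth_actions :: 'a scissors_class"
  let ?q = "\<lambda>c. ?S3 #>\<^bsub>red_Pt\<^esub> (?S2 #>\<^bsub>Pt\<^esub> (?S1 #>\<^bsub>?F\<^esub> c))"
  have q1: "(\<lambda>c. ?S1 #>\<^bsub>?F\<^esub> c) \<in> hom ?F Pt"
    unfolding Pt_def
    by (intro normal.r_coset_hom_Mod comm_group.normal_iff_subgroup[THEN iffD2]
        abelian_free_Abelian_group subgroup_subdivision)
  have q2: "(\<lambda>c. ?S2 #>\<^bsub>Pt\<^esub> c) \<in> hom Pt red_Pt"
    unfolding red_Pt_def
    by (intro normal.r_coset_hom_Mod comm_group.normal_iff_subgroup[THEN iffD2]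
        comm_group_Pt subgroup_suspension)
  have q3: "(\<lambda>c. ?S3 #>\<^bsub>red_Pt\<^esub> c) \<in> hom red_Pt scissors_group"
    unfolding scissors_group_def coinvariants_def
    by (intro normal.r_coset_hom_Mod comm_group.normal_iff_subgroup[THEN iffD2]
        comm_group_red_Pt subgroup_coinvariant orth_actions_hom)
  have q: "?q \<in> hom ?F scissors_group"
    using hom_compose[OF hom_compose[OF q1 q2] q3] by (simp add: o_def)
  obtain c where c: "c \<in> carrier ?F" "x = ?q c"
    using x by (auto simp: scissors_group_def coinvariants_def red_Pt_def Pt_def carrier_FactGroup
        simp del: carrier_free_Abelian_group_iff)
  let ?G = "scissors_group :: 'a scissors_class monoid"
  have G: "group ?G" using comm_group_scissors_group by (rule comm_group.axioms(2))
  interpret dq: group_hom ?F K "D \<circ> ?q"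
    using K hom_compose[OF q D] by (simp add: group_hom_def group_hom_axioms_def)
  interpret dq': group_hom ?F K "D' \<circ> ?q"
    using K hom_compose[OF q D'] by (simp add: group_hom_def group_hom_axioms_def)
  have "Poly_Mapping.keys c \<subseteq> simplices" using c by simp
  then have "(D \<circ> ?q) c = (D' \<circ> ?q) c"
  proof (rule free_Abelian_group_induct[where P = "\<lambda>c. (D \<circ> ?q) c = (D' \<circ> ?q) c"])
    show "(D \<circ> ?q) 0 = (D' \<circ> ?q) 0" using dq.hom_one dq'.hom_one by simp
  next
    fix a b
    assume 2: "Poly_Mapping.keys a \<subseteq> simplices" "Poly_Mapping.keys b \<subseteq> simplices"
      "(D \<circ> ?q) a = (D' \<circ> ?q) a" "(D \<circ> ?q) b = (D' \<circ> ?q) b"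
    have ab: "a \<in> carrier ?F" "- b \<in> carrier ?F" "b \<in> carrier ?F" using 2 by simp_all
    have e: "a - b = a \<otimes>\<^bsub>?F\<^esub> inv\<^bsub>?F\<^esub> b" using 2 by simp
    have i: "inv\<^bsub>?F\<^esub> b \<in> carrier ?F" using 2 by simp
    show "(D \<circ> ?q) (a - b) = (D' \<circ> ?q) (a - b)"
      unfolding e dq.hom_mult[OF ab(1) i] dq'.hom_mult[OF ab(1) i] dq.hom_inv[OF ab(3)]
        dq'.hom_inv[OF ab(3)] 2(3) 2(4) ..
  next
    fix B :: "'a set" assume "B \<in> simplices"
    then show "(D \<circ> ?q) (frag_of B) = (D' \<circ> ?q) (frag_of B)"
      using eq[of B] by (simp add: simplex_class_def red_Pt_class_def Pt_class_def)
  qed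
  then show ?thesis using c by simp
qed

lemma is_Dehn_invariant_unique:
  assumes "is_Dehn_invariant D" "is_Dehn_invariant D'" "x \<in> carrier scissors_group"
  shows "D x = D' x"
  by (rule scissors_group_hom_eqI[where K = scissors_S1_tensor_S1])
     (use assms in \<open>auto simp: is_Dehn_invariant_def intro!: comm_group.axioms(2)
        comm_group_tensor_product comm_group_scissors_group\<close>)

subsection \<open>Projections and arcs\<close>

lemma orth_proj:
  assumes "subspace W"
  shows "orth_proj W x \<in> W" "x - orth_proj W x \<in> W\<^sup>\<bottom>"
proof -
  have "\<exists>!y. y \<in> W \<and> x - y \<in> W\<^sup>\<bottom>"
  proof -
    obtain y z where yz: "y \<in> span W" "\<And>w. w \<in> span W \<Longrightarrow> orthogonal z w" "x = y + z"
      using orthogonal_subspace_decomp_exists[of W x] by metis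
    have sW: "span W = W" using assms by simp
    have "x - y \<in> W\<^sup>\<bottom>"
      using yz sW by (auto simp: orthogonal_comp_def orthogonal_commute)
    moreover have "y' = y" if "y' \<in> W" "x - y' \<in> W\<^sup>\<bottom>" for y'
    proof -
      have "(x - y) - (x - y') \<in> W\<^sup>\<bottom>"
        by (rule subspace_diff[OF subspace_orthogonal_comp \<open>x - y \<in> W\<^sup>\<bottom>\<close> that(2)])
      moreover have "y' - y \<in> W" using that yz sW assms by (simp add: subspace_diff)
      moreover have "(x - y) - (x - y') = y' - y" by simp
      ultimately have "orthogonal (y' - y) (y' - y)" by (auto simp: orthogonal_comp_def)
      then show ?thesis by (simp add: orthogonal_def)
    qed
    ultimately show ?thesis using yz sW by blast
  qed
  then have "orth_proj W x \<in> W \<and> x - orth_proj W x \<in> W\<^sup>\<bottom>"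
    unfolding orth_proj_def by (rule theI')
  then show "orth_proj W x \<in> W" "x - orth_proj W x \<in> W\<^sup>\<bottom>" by auto
qed

lemma plane_isometry_exists:
  fixes W :: "'a::euclidean_space set"
  assumes "subspace W" "dim W = 2"
  shows "\<exists>f. plane_isometry W f"
proof -
  obtain f where "linear f" "f ` W = (UNIV :: (real ^ 2) set)" "\<And>x. x \<in> W \<Longrightarrow> norm (f x) = norm x"
    by (rule isometries_subspaces[OF assms(1), of "UNIV :: (real ^ 2) set"]) (use assms(2) in auto)
  then show ?thesis by (auto simp: plane_isometry_def)
qed

lemma arc_in_simplices:
  assumes S: "independent S" "card S = 2" and f: "plane_isometry (span S) f"
  shows "f ` (sgn ` S) \<in> simplices"
proof -
  have lin: "linear f" and nrm: "\<And>x. x \<in> span S \<Longrightarrow> norm (f x) = norm x" and onto: "f ` span S = UNIV"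
    using f by (auto simp: plane_isometry_def)
  have nz: "x \<noteq> 0" if "x \<in> S" for x using S that dependent_zero by blast
  have sgn_in: "sgn x \<in> span S" if "x \<in> S" for x
    using that by (simp add: sgn_div_norm span_base span_scale)
  have fin: "finite (f ` (sgn ` S))" using S independent_imp_finite by blast
  have "x \<in> span (sgn ` S)" if "x \<in> S" for x
  proof -
    have "norm x *\<^sub>R sgn x \<in> span (sgn ` S)" using that by (intro span_scale span_base) auto
    then show ?thesis using nz[OF that] by (simp add: sgn_div_norm)
  qed
  then have "span S \<subseteq> span (sgn ` S)" by (intro span_minimal) auto
  then have sp: "span (f ` (sgn ` S)) = UNIV"
    using onto unfolding linear_span_image[OF lin] by blast
  have le: "card (f ` (sgn ` S)) \<le> 2"
    using card_image_le[of S "f \<circ> sgn"] S independent_imp_finite[OF S(1)] by (simp add: image_image)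
  have "independent (f ` (sgn ` S))"
    by (rule card_le_dim_spanning[of _ UNIV]) (use sp fin le in auto)
  moreover have "DIM(real ^ 2) \<le> card (f ` (sgn ` S))"
    using dim_le_card'[OF fin] dim_span[of "f ` (sgn ` S)"] sp by simp
  moreover have "f ` (sgn ` S) \<subseteq> sphere 0 1"
    using nz nrm[OF sgn_in] by (auto simp: norm_sgn)
  ultimately show ?thesis using le by (simp add: simplices_def)
qed

lemma arc_class_eq:
  assumes S: "independent S" "card S = 2" and f: "plane_isometry (span S) f"
  shows "arc_class S = simplex_class (f ` (sgn ` S))"
proof -
  let ?W = "span S"
  define h where "h = (SOME h. plane_isometry ?W h)"
  have h: "plane_isometry ?W h"
    unfolding h_def by (rule someI[of _ f]) (rule f)
  have f': "linear f" "\<And>x. x \<in> ?W \<Longrightarrow> norm (f x) = norm x" "f ` ?W = UNIV"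
    and h': "linear h" "\<And>x. x \<in> ?W \<Longrightarrow> norm (h x) = norm x" "h ` ?W = UNIV"
    using f h by (auto simp: plane_isometry_def)
  have inj: "inj_on f ?W"
  proof (rule inj_onI)
    fix x y assume xy: "x \<in> ?W" "y \<in> ?W" "f x = f y"
    have "norm (x - y) = norm (f (x - y))"
      using f'(2)[OF span_diff[OF xy(1,2)]] by simp
    also have "\<dots> = 0" using xy(3) by (simp add: linear_diff[OF f'(1)])
    finally show "x = y" by simp
  qed
  define k where "k = inv_into ?W f"
  have k1: "k y \<in> ?W" and k2: "f (k y) = y" for y
  proof -
    have "y \<in> f ` ?W" unfolding f'(3) by (rule UNIV_I)
    then show "k y \<in> ?W" "f (k y) = y"
      unfolding k_def by (rule inv_into_into, rule f_inv_into_f)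
  qed
  have kf: "k (f x) = x" if "x \<in> ?W" for x
    unfolding k_def using inj that by (rule inv_into_f_f)
  have "linear k"
  proof (rule linearI)
    show "k (x + y) = k x + k y" for x y
      using kf[OF span_add[OF k1[of x] k1[of y]]] by (simp only: linear_add[OF f'(1)] k2)
    show "k (c *\<^sub>R x) = c *\<^sub>R k x" for c x
      using kf[OF span_scale[OF k1[of x], of c]] by (simp only: linear_scale[OF f'(1)] k2)
  qed
  moreover have "norm (h (k y)) = norm y" for y
    using h'(2)[OF k1] f'(2)[OF k1] by (simp only: k2)
  ultimately have orth: "orthogonal_transformation (h \<circ> k)"
    using h'(1) by (simp add: orthogonal_transformation linear_compose)
  have sub: "sgn x \<in> ?W" if "x \<in> S" for x
    using that by (simp add: sgn_div_norm span_base span_scale)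
  have "(h \<circ> k) ` (f ` (sgn ` S)) = h ` (sgn ` S)"
    unfolding image_image o_def by (rule image_cong[OF refl]) (simp add: kf[OF sub])
  then show ?thesis
    using simplex_class_image[OF orth arc_in_simplices[OF S f]]
    unfolding arc_class_def h_def by (rule subst)
qed

end

(* An additive function f on the reals with f(pi) = 0 turns the angle of an arc into a homomorphism
   from the scissors group of the circle to the reals: angles add up under subdivision, and a
   suspension contributes f(pi/2) + f(pi/2) = 0.  Two such functions f, g detect the tensor x (x) y
   through f(x) g(y).

   Take the spherical orthoscheme whose dihedral angles are three right angles, pi/4 twice, and beta
   with cos beta = 3/10.  Only the edge at beta, of length m with cos m = 15/41, contributes to the
   value of f (x) g on the Dehn invariant, because f and g kill pi/2 and pi/4.

   Both 5 exp(i beta) and 41 exp(i m) lie in the ring Z[rho], where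
   rho = 5 exp(i beta) = (3 + sqrt(-91))/2; reductions modulo 5 and 41 show that pi, beta, m are
   linearly independent over the rationals.  Hence f and g can be chosen with
   f(m) g(beta) = 1 and f(beta) g(m) = 0. *)
theory Submission
  imports Defs
begin

section \<open>Homomorphisms to the reals\<close>

text \<open>Over the rationals and modulo pi, a pure tensor equals its swap only if its two angles
  are linearly dependent. The dihedral angles of an orthoscheme that need not be right are three in
  number; the lengths are tuned so that two of them become pi/4, and with one term left nothing can
  cancel the asymmetry.

  The primes 5 and 41 are the denominators of exp(i beta) and exp(i m). Both split in Z[rho]. The
  elements 5 exp(i beta) and 41 exp(i m) have norms 25 and 41^2 without being divisible by 5 or 41
  respectively, so each vanishes at one of the two primes above its denominator and not at the
  other. An integer relation between the angles would make a product of powers of these elements or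
  their conjugates a rational integer divisible by 5 or 41, hence zero at both primes.\<close>

definition real_add_group :: "real monoid" where
  "real_add_group = \<lparr>carrier = UNIV, mult = (+), one = 0\<rparr>"

lemma real_add_group_simps [simp]:
  "carrier real_add_group = UNIV" "x \<otimes>\<^bsub>real_add_group\<^esub> y = x + y" "\<one>\<^bsub>real_add_group\<^esub> = 0"
  by (simp_all add: real_add_group_def)

lemma comm_group_real_add_group: "comm_group real_add_group"
proof (rule comm_groupI)
  show "\<exists>y\<in>carrier real_add_group. y \<otimes>\<^bsub>real_add_group\<^esub> x = \<one>\<^bsub>real_add_group\<^esub>" for x
    by (auto intro: exI[of _ "- x"])
qed auto

lemma group_real_add_group: "group real_add_group"
  using comm_group_real_add_group by (rule comm_group.axioms(2))

text \<open>All quotients in the definitions are by subgroups generated by explicit relations, so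
  this one form serves the tensor product and each of the three quotient steps that lead to the
  scissors group.\<close>

lemma FactGroup_generate_universal:
  assumes "comm_group G" "group K" "h \<in> hom G K" "R \<subseteq> carrier G"
    and R: "\<And>r. r \<in> R \<Longrightarrow> h r = \<one>\<^bsub>K\<^esub>"
  obtains k where "k \<in> hom (G Mod generate G R) K"
    "\<And>x. x \<in> carrier G \<Longrightarrow> k (generate G R #>\<^bsub>G\<^esub> x) = h x"
proof -
  interpret G: comm_group G by fact
  interpret K: group K by fact
  interpret h: group_hom G K h
    using assms(3) by (unfold_locales)
  let ?N = "generate G R"
  have sub: "subgroup ?N G" using assms(4) by (rule G.generate_is_subgroup)
  have "generate G R \<subseteq> kernel G K h"
    using assms(4) R by (intro G.generate_subgroup_incl h.subgroup_kernel) (auto simp: kernel_def)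
  then have ker: "h n = \<one>\<^bsub>K\<^esub>" if "n \<in> ?N" for n
    using that by (auto simp: kernel_def)
  have "h x = h y" if "x \<in> carrier G" "y \<in> carrier G" "?N #>\<^bsub>G\<^esub> x = ?N #>\<^bsub>G\<^esub> y" for x y
  proof -
    have "x \<in> ?N #>\<^bsub>G\<^esub> y" using G.rcos_self[OF that(1) sub] that(3) by simp
    then obtain n where "n \<in> ?N" "x = n \<otimes>\<^bsub>G\<^esub> y" by (auto simp: r_coset_def)
    then show ?thesis
      using ker[of n] that subgroup.mem_carrier[OF sub, of n] by simp
  qed
  moreover have "?N \<lhd> G" using sub by (simp add: G.normal_iff_subgroup)
  ultimately obtain k where "k \<in> hom (G Mod ?N) K" "\<And>x. x \<in> carrier G \<Longrightarrow> k (?N #>\<^bsub>G\<^esub> x) = h x"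
    using FactGroup_universal[OF assms(3), of ?N] by blast
  then show thesis by (rule that)
qed

lemma (in comm_monoid) hom_finprod_real_add:
  assumes "h \<in> hom G real_add_group" "finite A" "f \<in> A \<rightarrow> carrier G"
  shows "h (finprod G f A) = (\<Sum>a\<in>A. h (f a))"
  using assms(2,3)
proof (induction rule: finite_induct)
  case empty
  have "h (\<one> \<otimes> \<one>) = h \<one> + h \<one>"
    using assms(1) by (subst hom_mult[OF assms(1)]) auto
  then show ?case by simp
next
  case (insert a A)
  then show ?case
    using hom_mult[OF assms(1), of "f a" "finprod G f A"] by (auto simp: Pi_iff)
qed

text \<open>Two additive characters multiply to a biadditive map on pairs, by distributivity in the
  reals; its free extension therefore kills the bilinear relations.\<close>

lemma tensor_product_universal_real:
  fixes G :: "('g, 'm) monoid_scheme" and H :: "('h, 'n) monoid_scheme"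
  assumes G: "comm_group G" and H: "comm_group H"
    and a: "a \<in> hom G real_add_group" and b: "b \<in> hom H real_add_group"
  obtains T where "T \<in> hom (tensor_product G H) real_add_group"
    "\<And>x y. x \<in> carrier G \<Longrightarrow> y \<in> carrier H \<Longrightarrow> T (pure_tensor G H x y) = a x * b y"
proof -
  let ?F = "free_Abelian_group (carrier G \<times> carrier H)"
  obtain h where h: "h \<in> hom ?F real_add_group"
      "\<And>p. p \<in> carrier G \<times> carrier H \<Longrightarrow> h (frag_of p) = a (fst p) * b (snd p)"
    using comm_group.free_Abelian_group_universal[OF comm_group_real_add_group,
        of "\<lambda>p. a (fst p) * b (snd p)" "carrier G \<times> carrier H"] by auto
  interpret h: group_hom ?F real_add_group h
    using h(1) group_real_add_group by (simp add: group_hom_def group_hom_axioms_def)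
  have diff: "h (frag_of p - frag_of q - frag_of s) = h (frag_of p) - h (frag_of q) - h (frag_of s)"
    if "p \<in> carrier G \<times> carrier H" "q \<in> carrier G \<times> carrier H" "s \<in> carrier G \<times> carrier H" for p q s
  proof -
    have k: "Poly_Mapping.keys (frag_of p - frag_of q - frag_of s) \<subseteq> carrier G \<times> carrier H"
      using that
        keys_diff[of "frag_of p - frag_of q" "frag_of s"] keys_diff[of "frag_of p" "frag_of q"] by auto
    have k': "Poly_Mapping.keys (frag_of p - frag_of q) \<subseteq> carrier G \<times> carrier H"
      using that keys_diff[of "frag_of p" "frag_of q"] by auto
    have "h (frag_of p) = h ((frag_of p - frag_of q) + frag_of q)" by simp
    also have "\<dots> = h (frag_of p - frag_of q) + h (frag_of q)"
      using h.hom_mult[of "frag_of p - frag_of q" "frag_of q"] k' that by simp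
    also have "h (frag_of p - frag_of q) = h ((frag_of p - frag_of q - frag_of s) + frag_of s)" by simp
    also have "\<dots> = h (frag_of p - frag_of q - frag_of s) + h (frag_of s)"
      using h.hom_mult[of "frag_of p - frag_of q - frag_of s" "frag_of s"] k that by simp
    finally show ?thesis by simp
  qed
  have mG: "x \<otimes>\<^bsub>G\<^esub> x' \<in> carrier G" if "x \<in> carrier G" "x' \<in> carrier G" for x x'
    using G that by (simp add: comm_group_def group_def monoid.m_closed)
  have mH: "x \<otimes>\<^bsub>H\<^esub> x' \<in> carrier H" if "x \<in> carrier H" "x' \<in> carrier H" for x x'
    using H that by (simp add: comm_group_def group_def monoid.m_closed)
  have "h r = \<one>\<^bsub>real_add_group\<^esub>" if "r \<in> bilinear_relations G H" for r
    using that unfolding bilinear_relations_def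
    by (elim UnE CollectE exE conjE; hypsubst; subst diff)
       (simp_all add: h(2) mG mH hom_mult[OF a] hom_mult[OF b] ring_distribs)
  from FactGroup_generate_universal[OF abelian_free_Abelian_group group_real_add_group h(1)
      bilinear_relations_subset[OF G H] this]
  obtain T where "T \<in> hom (tensor_product G H) real_add_group"
      "\<And>x. x \<in> carrier ?F \<Longrightarrow> T (bilinear_subgroup G H #>\<^bsub>?F\<^esub> x) = h x"
    unfolding tensor_product_def bilinear_subgroup_def by blast
  then show thesis
    using h(2) by (intro that[of T]) (auto simp: pure_tensor_def)
qed

section \<open>Real-valued functionals on the scissors group\<close>

lemma free_Abelian_group_hom_eqI:
  assumes "group K" "h \<in> hom (free_Abelian_group S) K" "k \<in> hom (free_Abelian_group S) K"
    and eq: "\<And>s. s \<in> S \<Longrightarrow> h (frag_of s) = k (frag_of s)"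
    and c: "c \<in> carrier (free_Abelian_group S)"
  shows "h c = k c"
proof -
  let ?F = "free_Abelian_group S"
  interpret h: group_hom ?F K h using assms by (simp add: group_hom_def group_hom_axioms_def)
  interpret k: group_hom ?F K k using assms by (simp add: group_hom_def group_hom_axioms_def)
  have "Poly_Mapping.keys c \<subseteq> S" using c by simp
  then show ?thesis
  proof (rule free_Abelian_group_induct[where P = "\<lambda>c. h c = k c"])
    show "h 0 = k 0" using h.hom_one k.hom_one by simp
  next
    fix a b
    assume 2: "Poly_Mapping.keys a \<subseteq> S" "Poly_Mapping.keys b \<subseteq> S" "h a = k a" "h b = k b"
    then have e: "a - b = a \<otimes>\<^bsub>?F\<^esub> inv\<^bsub>?F\<^esub> b" "a \<in> carrier ?F" "b \<in> carrier ?F" by simp_all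
    show "h (a - b) = k (a - b)"
      unfolding e(1) h.hom_mult[OF e(2) h.G.inv_closed[OF e(3)]] k.hom_mult[OF e(2) h.G.inv_closed[OF e(3)]]
        h.hom_inv[OF e(3)] k.hom_inv[OF e(3)] 2(3,4) ..
  qed (use eq in auto)
qed

text \<open>A weight on simplices extends freely to chains and then descends through three
  successive quotients; each hypothesis is what one of them demands.\<close>

lemma scissors_group_universal_real:
  fixes \<phi> :: "'a::euclidean_space set \<Rightarrow> real"
  assumes sub: "\<And>P \<Q>. subdivides \<Q> P \<Longrightarrow> \<phi> P = (\<Sum>Q\<in>\<Q>. \<phi> Q)"
    and susp: "\<And>v B. susp_cond v B \<Longrightarrow> \<phi> (insert v B) + \<phi> (insert (- v) B) = 0"
    and orth: "\<And>g B. orthogonal_transformation g \<Longrightarrow> B \<in> simplices \<Longrightarrow> \<phi> (g ` B) = \<phi> B"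
  obtains h where "h \<in> hom scissors_group real_add_group"
    "\<And>B. B \<in> simplices \<Longrightarrow> h (simplex_class B) = \<phi> B"
proof -
  let ?F = "free_Abelian_group (simplices :: 'a set set)"
  obtain h0 where h0: "h0 \<in> hom ?F real_add_group" "\<And>B. B \<in> simplices \<Longrightarrow> h0 (frag_of B) = \<phi> B"
    using comm_group.free_Abelian_group_universal[OF comm_group_real_add_group, of \<phi> simplices] by auto
  interpret h0: group_hom ?F real_add_group h0
    using h0(1) group_real_add_group by (simp add: group_hom_def group_hom_axioms_def)
  have r0: "h0 r = \<one>\<^bsub>real_add_group\<^esub>"
    if "r \<in> {frag_of P - (\<Sum>Q\<in>\<Q>. frag_of Q) | P \<Q>. subdivides \<Q> P}" for r
  proof -
    from that obtain P \<Q> where s: "subdivides \<Q> P" and r: "r = frag_of P - (\<Sum>Q\<in>\<Q>. frag_of Q)" by auto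
    have fin: "finite \<Q>" "\<Q> \<subseteq> simplices" "P \<in> simplices" using s by (auto simp: subdivides_def)
    have sums: "Poly_Mapping.keys (\<Sum>Q\<in>\<R>. frag_of Q) \<subseteq> simplices \<and>
        h0 (\<Sum>Q\<in>\<R>. frag_of Q) = (\<Sum>Q\<in>\<R>. \<phi> Q)" if "\<R> \<subseteq> \<Q>" for \<R>
      using finite_subset[OF that fin(1)] that
    proof (induction rule: finite_induct)
      case empty
      then show ?case using h0.hom_one by simp
    next
      case (insert Q \<R>)
      have "Poly_Mapping.keys (frag_of Q + (\<Sum>Q\<in>\<R>. frag_of Q)) \<subseteq> simplices"
        using insert fin keys_add[of "frag_of Q" "\<Sum>Q\<in>\<R>. frag_of Q"] by fastforce
      moreover have "h0 (frag_of Q + (\<Sum>Q\<in>\<R>. frag_of Q)) = \<phi> Q + (\<Sum>Q\<in>\<R>. \<phi> Q)"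
        using insert fin h0.hom_mult[of "frag_of Q" "\<Sum>Q\<in>\<R>. frag_of Q"] h0(2) by auto
      ultimately show ?case using insert by simp
    qed
    have "r \<in> carrier ?F" using subdivision_relations_subset that by blast
    then have "h0 (r + (\<Sum>Q\<in>\<Q>. frag_of Q)) = h0 r + h0 (\<Sum>Q\<in>\<Q>. frag_of Q)"
      using h0.hom_mult[of r "\<Sum>Q\<in>\<Q>. frag_of Q"] sums[of \<Q>] by simp
    moreover have "h0 (r + (\<Sum>Q\<in>\<Q>. frag_of Q)) = \<phi> P" using r h0(2) fin by simp
    ultimately show ?thesis using sums[of \<Q>] sub[OF s] by simp
  qed
  from FactGroup_generate_universal[OF abelian_free_Abelian_group group_real_add_group h0(1)
      subdivision_relations_subset r0]
  obtain h1 where h1: "h1 \<in> hom Pt real_add_group"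
      "\<And>c. c \<in> carrier ?F \<Longrightarrow> h1 (subdivision_subgroup #>\<^bsub>?F\<^esub> c) = h0 c"
    unfolding Pt_def subdivision_subgroup_def by blast
  have h1': "h1 (Pt_class B) = \<phi> B" if "B \<in> simplices" for B
    using that h1(2) h0(2) by (simp add: Pt_class_def)
  have r1: "h1 r = \<one>\<^bsub>real_add_group\<^esub>"
    if "r \<in> {Pt_class (insert v B) \<otimes>\<^bsub>Pt\<^esub> Pt_class (insert (- v) B) | v B. susp_cond v B}" for r
  proof -
    from that obtain v B where s: "susp_cond v B"
      and r: "r = Pt_class (insert v B) \<otimes>\<^bsub>Pt\<^esub> Pt_class (insert (- v) B)" by auto
    have "- v \<in> (span B)\<^sup>\<bottom>" using s by (simp add: subspace_neg subspace_orthogonal_comp)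
    then have ins: "insert v B \<in> simplices" "insert (- v) B \<in> simplices"
      using s by (auto intro: insert_in_simplices)
    show ?thesis
      unfolding r using susp[OF s] hom_mult[OF h1(1) Pt_class_closed[OF ins(1)] Pt_class_closed[OF ins(2)]]
      by (simp add: h1'[OF ins(1)] h1'[OF ins(2)])
  qed
  from FactGroup_generate_universal[OF comm_group_Pt group_real_add_group h1(1)
      suspension_relations_subset r1]
  obtain h2 where h2: "h2 \<in> hom red_Pt real_add_group"
      "\<And>c. c \<in> carrier Pt \<Longrightarrow> h2 (suspension_subgroup #>\<^bsub>Pt\<^esub> c) = h1 c"
    unfolding red_Pt_def suspension_subgroup_def by blast
  have h2': "h2 (red_Pt_class B) = \<phi> B" if "B \<in> simplices" for B
    using that h2(2) h1' by (simp add: red_Pt_class_def Pt_class_closed)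
  interpret h2: group_hom red_Pt real_add_group h2
    using h2(1) group_real_add_group group_red_Pt by (simp add: group_hom_def group_hom_axioms_def)
  let ?q = "\<lambda>c. suspension_subgroup #>\<^bsub>Pt\<^esub> (subdivision_subgroup #>\<^bsub>?F\<^esub> c) :: ('a set \<Rightarrow>\<^sub>0 int) set set"
  have q1: "(\<lambda>c. subdivision_subgroup #>\<^bsub>?F\<^esub> c) \<in> hom ?F Pt"
    unfolding Pt_def
    by (intro normal.r_coset_hom_Mod comm_group.normal_iff_subgroup[THEN iffD2]
        abelian_free_Abelian_group subgroup_subdivision)
  have q2: "(\<lambda>c. suspension_subgroup #>\<^bsub>Pt\<^esub> c) \<in> hom Pt red_Pt"
    unfolding red_Pt_def
    by (intro normal.r_coset_hom_Mod comm_group.normal_iff_subgroup[THEN iffD2]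
        comm_group_Pt subgroup_suspension)
  have q: "?q \<in> hom ?F red_Pt"
    using hom_compose[OF q1 q2] by (simp add: o_def)
  \<comment> \<open>The coinvariance relations involve every element of \<open>red_Pt\<close>,
    whereas \<open>orth\<close> speaks of single simplices. Every element is the image of a chain
    and both sides are homomorphisms on chains, so it suffices to compare them on
    generators.\<close>
  have inv: "h2 (\<alpha> x) = h2 x" if "\<alpha> \<in> orth_actions" "x \<in> carrier red_Pt" for \<alpha> x
  proof -
    from that obtain g :: "'a \<Rightarrow> 'a" where g: "orthogonal_transformation g" "\<alpha> = red_Pt_action g" by auto
    from that obtain c where c: "c \<in> carrier ?F" "x = ?q c"
      by (auto simp: red_Pt_def Pt_def carrier_FactGroup simp del: carrier_free_Abelian_group_iff)
    have "(h2 \<circ> (\<alpha> \<circ> ?q)) c = (h2 \<circ> ?q) c"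
    proof (rule free_Abelian_group_hom_eqI[OF group_real_add_group _ _ _ c(1)])
      show "h2 \<circ> (\<alpha> \<circ> ?q) \<in> hom ?F real_add_group" "h2 \<circ> ?q \<in> hom ?F real_add_group"
        using hom_compose[OF hom_compose[OF q red_Pt_action_hom[OF g(1)]] h2(1)]
          hom_compose[OF q h2(1)] g(2) by simp_all
    next
      fix B :: "'a set" assume B: "B \<in> simplices"
      then have "\<alpha> (?q (frag_of B)) = red_Pt_class (g ` B)"
        using red_Pt_action_class[OF g(1) B] g(2) by (simp add: red_Pt_class_def Pt_class_def)
      then show "(h2 \<circ> (\<alpha> \<circ> ?q)) (frag_of B) = (h2 \<circ> ?q) (frag_of B)"
        using h2'[OF B] h2'[OF image_in_simplices[OF g(1) B]] orth[OF g(1) B]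
        by (simp add: red_Pt_class_def Pt_class_def)
    qed
    then show ?thesis using c(2) by simp
  qed
  have r2: "h2 r = \<one>\<^bsub>real_add_group\<^esub>"
    if "r \<in> {\<alpha> x \<otimes>\<^bsub>red_Pt\<^esub> inv\<^bsub>red_Pt\<^esub> x | \<alpha> x. \<alpha> \<in> orth_actions \<and> x \<in> carrier red_Pt}" for r
  proof -
    from that obtain \<alpha> x where r: "r = \<alpha> x \<otimes>\<^bsub>red_Pt\<^esub> inv\<^bsub>red_Pt\<^esub> x" "\<alpha> \<in> orth_actions" "x \<in> carrier red_Pt"
      by auto
    have "\<alpha> x \<in> carrier red_Pt"
      by (rule hom_in_carrier[OF subsetD[OF orth_actions_hom r(2)] r(3)])
    then have "h2 r = h2 x \<otimes>\<^bsub>real_add_group\<^esub> h2 (inv\<^bsub>red_Pt\<^esub> x)"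
      using r inv by simp
    also have "\<dots> = h2 (x \<otimes>\<^bsub>red_Pt\<^esub> inv\<^bsub>red_Pt\<^esub> x)"
      by (rule h2.hom_mult[OF r(3) h2.G.inv_closed[OF r(3)], symmetric])
    also have "\<dots> = \<one>\<^bsub>real_add_group\<^esub>"
      unfolding h2.G.r_inv[OF r(3)] by (rule h2.hom_one)
    finally show ?thesis .
  qed
  have sub2: "{\<alpha> x \<otimes>\<^bsub>red_Pt\<^esub> inv\<^bsub>red_Pt\<^esub> x | \<alpha> x. \<alpha> \<in> orth_actions \<and> x \<in> carrier red_Pt} \<subseteq> carrier (red_Pt :: ('a set \<Rightarrow>\<^sub>0 int) set set monoid)"
  proof
    fix r :: "('a set \<Rightarrow>\<^sub>0 int) set set"
    assume "r \<in> {\<alpha> x \<otimes>\<^bsub>red_Pt\<^esub> inv\<^bsub>red_Pt\<^esub> x | \<alpha> x. \<alpha> \<in> orth_actions \<and> x \<in> carrier red_Pt}"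
    then obtain \<alpha> x where *: "r = \<alpha> x \<otimes>\<^bsub>red_Pt\<^esub> inv\<^bsub>red_Pt\<^esub> x" "\<alpha> \<in> orth_actions" "x \<in> carrier red_Pt"
      by auto
    show "r \<in> carrier red_Pt"
      unfolding *(1)
      by (intro h2.G.m_closed h2.G.inv_closed *(3) hom_in_carrier[OF subsetD[OF orth_actions_hom *(2)] *(3)])
  qed
  from FactGroup_generate_universal[OF comm_group_red_Pt group_real_add_group h2(1) sub2 r2]
  obtain h3 where h3: "h3 \<in> hom scissors_group real_add_group"
      "\<And>c. c \<in> carrier red_Pt \<Longrightarrow> h3 (coinvariant_subgroup red_Pt orth_actions #>\<^bsub>red_Pt\<^esub> c) = h2 c"
    unfolding scissors_group_def coinvariants_def coinvariant_subgroup_def by blast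
  show thesis
    using h3 h2' by (intro that[of h3]) (simp_all add: simplex_class_def red_Pt_class_closed)
qed

section \<open>Rational independence of angles\<close>

definition rho :: complex where "rho = Complex (3/2) (sqrt 91 / 2)"

text \<open>Modulo 5 the polynomial X^2 - 3 X + 25 becomes X (X - 3). This is why \<open>rho\<close>
  may be sent to 3 in the field with five elements, although it goes to 0 at the conjugate
  prime.\<close>

lemma rho_power2: "rho * rho = 3 * rho - 25"
  by (simp add: rho_def complex_eq_iff)

text \<open>Serves the inductions below: \<open>v\<close> is the residue of the element built so
  far, \<open>c\<close> that of the new factor, and \<open>l * m\<close> is the discrepancy between
  the residue computed from coordinates and the product.\<close>

lemma not_dvd_times_add:
  fixes v :: int
  assumes "prime l" "\<not> l dvd v" "\<not> l dvd c"
  shows "\<not> l dvd l * m + c * v"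
  using assms by (simp add: dvd_add_right_iff prime_dvd_mult_iff)

text \<open>The ring homomorphism from \<open>\<int>[\<rho>]\<close> to the field with five elements that sends \<open>\<rho>\<close> to 3
  kills neither \<open>\<rho>\<close> nor \<open>\<sigma> = 8 \<rho> + 3\<close> nor the conjugate \<open>27 - 8 \<rho>\<close> of \<open>\<sigma>\<close>.\<close>

lemma rho_monomial_mod5:
  fixes c d :: int
  assumes cd: "\<not> 5 dvd c + 3 * d"
  shows "\<exists>x y. rho ^ p * (of_int c + of_int d * rho) ^ q = of_int x + of_int y * rho \<and> \<not> 5 dvd x + 3 * y"
proof (induction q)
  case 0
  show ?case
  proof (induction p)
    case 0
    show ?case by (rule exI[of _ 1], rule exI[of _ 0]) simp
  next
    case (Suc p)
    then obtain x y where xy: "rho ^ p = of_int x + of_int y * rho" "\<not> 5 dvd x + 3 * y" by auto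
    have "rho ^ Suc p = of_int x * rho + of_int y * (rho * rho)" using xy by (simp add: algebra_simps)
    also have "\<dots> = of_int (- 25 * y) + of_int (x + 3 * y) * rho"
      unfolding rho_power2 by (simp add: algebra_simps)
    finally have "rho ^ Suc p = \<dots>" .
    moreover have "\<not> 5 dvd - 25 * y + 3 * (x + 3 * y)"
      using not_dvd_times_add[of 5 "x + 3 * y" 3 "- 5 * y"] xy(2) by simp
    ultimately show ?case unfolding power_0 mult_1_right by blast
  qed
next
  case (Suc q)
  then obtain x y where xy: "rho ^ p * (of_int c + of_int d * rho) ^ q = of_int x + of_int y * rho"
      "\<not> 5 dvd x + 3 * y" by auto
  have "rho ^ p * (of_int c + of_int d * rho) ^ Suc q
      = (rho ^ p * (of_int c + of_int d * rho) ^ q) * (of_int c + of_int d * rho)"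
    by (simp add: mult_ac)
  also have "\<dots> = of_int x * of_int c + (of_int x * of_int d + of_int y * of_int c) * rho
      + of_int y * of_int d * (rho * rho)"
    unfolding xy(1) by (simp add: algebra_simps)
  also have "\<dots> = of_int (x * c - 25 * y * d) + of_int (x * d + y * c + 3 * y * d) * rho"
    unfolding rho_power2 by (simp add: algebra_simps)
  finally have "rho ^ p * (of_int c + of_int d * rho) ^ Suc q = \<dots>" .
  moreover have "\<not> 5 dvd (x * c - 25 * y * d) + 3 * (x * d + y * c + 3 * y * d)"
  proof -
    \<comment> \<open>Evaluation at 3 is multiplicative up to the multiple of 25 that stems from the
      constant term of the polynomial of \<open>rho\<close>.\<close>
    have "(x * c - 25 * y * d) + 3 * (x * d + y * c + 3 * y * d)
        = 5 * (- 5 * y * d) + (c + 3 * d) * (x + 3 * y)" by (simp add: algebra_simps)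
    then show ?thesis
      using not_dvd_times_add[of 5 "x + 3 * y" "c + 3 * d" "- 5 * y * d"] xy(2) cd
      by (simp only:) simp
  qed
  ultimately show ?case by blast
qed

definition sigma :: complex where "sigma = Complex 15 (4 * sqrt 91)"

text \<open>With 3 in place of \<open>rho\<close> these become 27 and 3, both prime to 5, which is
  the hypothesis \<open>cd\<close> of \<open>rho_monomial_mod5\<close>.\<close>

lemma sigma_rho: "sigma = of_int 3 + of_int 8 * rho" "cnj sigma = of_int 27 + of_int (- 8) * rho"
  by (simp_all add: sigma_def rho_def complex_eq_iff)

text \<open>Here the residue field has 41 elements and \<open>\<sigma>\<close> goes to 30.\<close>

lemma sigma_power_mod41:
  "\<exists>x y. sigma ^ Suc q = of_int x + of_int y * sigma \<and> \<not> 41 dvd x + 30 * y"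
proof (induction q)
  case 0
  show ?case by (rule exI[of _ 0], rule exI[of _ 1]) simp
next
  case (Suc q)
  then obtain x y where xy: "sigma ^ Suc q = of_int x + of_int y * sigma" "\<not> 41 dvd x + 30 * y" by auto
  \<comment> \<open>Since 1681 = 41^2, the polynomial X^2 - 30 X + 1681 is X (X - 30) modulo 41,
    whence the residue 30.\<close>
  have s: "sigma * sigma = 30 * sigma - 1681" by (simp add: sigma_def complex_eq_iff)
  have "sigma ^ Suc (Suc q) = sigma ^ Suc q * sigma" by simp
  also have "\<dots> = of_int x * sigma + of_int y * (sigma * sigma)"
    unfolding xy(1) by (simp add: algebra_simps)
  also have "\<dots> = of_int (- 1681 * y) + of_int (x + 30 * y) * sigma"
    unfolding s by (simp add: algebra_simps)
  finally have "sigma ^ Suc (Suc q) = \<dots>" .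
  moreover have "\<not> 41 dvd - 1681 * y + 30 * (x + 30 * y)"
    using not_dvd_times_add[of 41 "x + 30 * y" 30 "- 41 * y"] xy(2) by simp
  ultimately show ?case by blast
qed

section \<open>Integer relations between pi and the two angles\<close>

definition edge_length :: real where "edge_length = arccos (15/41)"
definition dihedral_angle :: real where "dihedral_angle = arccos (3/10)"

lemma cis_dihedral_angle: "5 * cis dihedral_angle = rho"
proof -
  have "sin dihedral_angle = sqrt (1 - (3/10)\<^sup>2)" unfolding dihedral_angle_def by (rule sin_arccos) auto
  also have "\<dots> = sqrt (91 / 10\<^sup>2)" by (simp add: power2_eq_square)
  also have "\<dots> = sqrt 91 / 10" by (simp only: real_sqrt_divide real_sqrt_abs)
  finally show ?thesis
    by (simp add: rho_def complex_eq_iff dihedral_angle_def)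
qed

lemma cis_edge_length: "41 * cis edge_length = sigma"
proof -
  have "sin edge_length = sqrt (1 - (15/41)\<^sup>2)" unfolding edge_length_def by (rule sin_arccos) auto
  also have "\<dots> = sqrt (91 * (4 / 41)\<^sup>2)" by (simp add: power2_eq_square)
  also have "\<dots> = sqrt 91 * (4 / 41)" by (simp only: real_sqrt_mult real_sqrt_abs)
  finally show ?thesis
    by (simp add: sigma_def complex_eq_iff edge_length_def)
qed

lemma cis_int_pi: "cis (of_int k * pi) = 1 \<or> cis (of_int k * pi) = -1"
proof -
  have "sin (of_int k * pi) = 0" by (simp add: sin_zero_iff_int2)
  moreover from this have "cos (of_int k * pi) ^ 2 = 1"
    using sin_cos_squared_add[of "of_int k * pi"] by simp
  ultimately show ?thesis by (auto simp: complex_eq_iff power2_eq_1_iff)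
qed

text \<open>Exponentiating gives \<open>rho ^ p * s ^ q\<close> = +-5^p 41^q, where \<open>s\<close>
  is \<open>sigma\<close> or its conjugate according to \<open>e\<close>. Conjugation stands in for
  a negative exponent, so the identity stays in Z[rho]. For \<open>p\<close> > 0 the right side
  vanishes modulo 5 and the left side does not; once \<open>p\<close> = 0, reduction modulo 41
  excludes \<open>q\<close> > 0.\<close>

lemma int_relation_nonneg:
  fixes k :: int and p q :: nat and e :: real
  assumes e: "e = 1 \<or> e = -1"
    and rel: "of_nat p * dihedral_angle + e * of_nat q * edge_length = of_int k * pi"
  shows "p = 0 \<and> q = 0"
proof -
  define s where "s = (if e = 1 then sigma else cnj sigma)"
  have s: "s = 41 * cis (e * edge_length)"
    using e cis_edge_length cis_cnj[of edge_length] unfolding s_def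
    by (auto simp flip: cis_edge_length)
  obtain u :: int where u: "u = 1 \<or> u = -1" "cis (of_int k * pi) = of_int u"
    using cis_int_pi[of k] by (metis of_int_1 of_int_minus)
  have demoivre: "cis dihedral_angle ^ p = cis (of_nat p * dihedral_angle)"
    "cis (e * edge_length) ^ q = cis (e * of_nat q * edge_length)"
    by (simp_all add: Complex.DeMoivre mult_ac)
  have "rho ^ p * s ^ q = 5 ^ p * 41 ^ q * cis (of_nat p * dihedral_angle + e * of_nat q * edge_length)"
    unfolding s cis_dihedral_angle[symmetric] power_mult_distrib cis_mult[symmetric]
      demoivre by (simp only: mult_ac)
  then have eq: "rho ^ p * s ^ q = of_int (5 ^ p * 41 ^ q * u)"
    unfolding rel u(2) by simp
  have im: "y = 0 \<and> x = z" if "of_int x + of_int y * rho = (of_int z :: complex)" for x y z :: int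
    using that by (auto simp: rho_def complex_eq_iff)
  have im': "y = 0 \<and> x = z" if "of_int x + of_int y * sigma = (of_int z :: complex)" for x y z :: int
    using that by (auto simp: sigma_def complex_eq_iff)
  have p: "p = 0"
  proof (rule ccontr)
    assume "p \<noteq> 0"
    have "\<exists>x y. rho ^ p * s ^ q = of_int x + of_int y * rho \<and> \<not> 5 dvd x + 3 * y"
      using rho_monomial_mod5[of 3 8 p q] rho_monomial_mod5[of 27 "- 8" p q]
      unfolding s_def sigma_rho(2) unfolding sigma_rho(1) by (cases "e = 1") simp_all
    then obtain x y where xy: "rho ^ p * s ^ q = of_int x + of_int y * rho" "\<not> 5 dvd x + 3 * y" by blast
    then have "x = 5 ^ p * 41 ^ q * u" "y = 0" using im eq by metis+
    then show False using xy(2) \<open>p \<noteq> 0\<close> by simp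
  qed
  moreover have "q = 0"
  proof (rule ccontr)
    assume "q \<noteq> 0"
    then obtain r where r: "q = Suc r" using not0_implies_Suc by blast
    have "s ^ q = of_int (41 ^ q * u)" using eq p by simp
    \<comment> \<open>The value is real, so conjugating carries the case of \<open>cnj sigma\<close>
      to that of \<open>sigma\<close>, and one residue map modulo 41 suffices.\<close>
    then have "cnj (s ^ q) = of_int (41 ^ q * u)" by simp
    then have sg: "sigma ^ Suc r = of_int (41 ^ q * u)"
      using \<open>s ^ q = of_int (41 ^ q * u)\<close> r unfolding s_def by (auto split: if_splits)
    from sigma_power_mod41[of r] obtain x y where
      xy: "sigma ^ Suc r = of_int x + of_int y * sigma" "\<not> 41 dvd x + 30 * y" by blast
    then have "x = 41 ^ q * u" "y = 0" using im' sg by metis+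
    then show False using xy(2) r by simp
  qed
  ultimately show ?thesis ..
qed

lemma int_relation:
  fixes p q k :: int
  assumes rel: "of_int p * dihedral_angle + of_int q * edge_length + of_int k * pi = 0"
  shows "p = 0 \<and> q = 0 \<and> k = 0"
proof -
  have pq: "p = 0 \<and> q = 0"
  proof -
    \<comment> \<open>A global change of sign makes the coefficient of \<open>dihedral_angle\<close>
      nonnegative; \<open>e\<close> keeps the relative sign of \<open>p\<close> and
      \<open>q\<close>.\<close>
    define e :: real where "e = (if (p \<ge> 0) = (q \<ge> 0) then 1 else -1)"
    define k' where "k' = (if p \<ge> 0 then - k else k)"
    have "of_nat (nat \<bar>p\<bar>) * dihedral_angle + e * of_nat (nat \<bar>q\<bar>) * edge_length = of_int k' * pi"
      using rel unfolding e_def k'_def by (cases "p \<ge> 0"; cases "q \<ge> 0"; simp; linarith)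
    from int_relation_nonneg[OF _ this] show ?thesis unfolding e_def by auto
  qed
  then show ?thesis using rel by simp
qed

text \<open>The reals are taken as a rational vector space, in which the three angles are
  independent, so values on them extend to a linear map. Such a map is discontinuous unless zero: a
  continuous additive function that kills pi vanishes identically.\<close>

lemma additive_functional_exists:
  obtains f :: "real \<Rightarrow> real" where "\<And>x y. f (x + y) = f x + f y" "f pi = 0"
    "f edge_length = a" "f dihedral_angle = b"
proof -
  let ?s = "\<lambda>(q::rat) (x::real). of_rat q * x"
  interpret vector_space_pair ?s ?s
    by unfold_locales (simp_all add: algebra_simps of_rat_add of_rat_mult)
  have ne: "edge_length \<noteq> pi" "dihedral_angle \<noteq> pi" "dihedral_angle \<noteq> edge_length"
    using int_relation[of 0 1 "-1"] int_relation[of 1 0 "-1"] int_relation[of 1 "-1" 0] by auto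
  have "vs1.independent {dihedral_angle, edge_length, pi}"
  proof (subst vs1.dependent_finite)
    show "\<not> (\<exists>u. (\<exists>v\<in>{dihedral_angle, edge_length, pi}. u v \<noteq> 0) \<and>
        (\<Sum>v\<in>{dihedral_angle, edge_length, pi}. of_rat (u v) * v) = 0)"
    proof clarify
      fix u v assume *: "(\<Sum>v\<in>{dihedral_angle, edge_length, pi}. of_rat (u v) * v) = 0"
        and v: "v \<in> {dihedral_angle, edge_length, pi}" "u v \<noteq> 0"
      obtain p d where p: "u dihedral_angle = of_int p / of_int d" "d > 0"
        by (metis Rat_cases Fract_of_int_quotient)
      obtain q d' where q: "u edge_length = of_int q / of_int d'" "d' > 0"
        by (metis Rat_cases Fract_of_int_quotient)
      obtain k d'' where k: "u pi = of_int k / of_int d''" "d'' > 0"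
        by (metis Rat_cases Fract_of_int_quotient)
      have "of_int p / of_int d * dihedral_angle + of_int q / of_int d' * edge_length
          + of_int k / of_int d'' * pi = 0"
        using * ne by (simp add: p q k of_rat_divide add.assoc)
      then have "of_int (p * d' * d'') * dihedral_angle + of_int (q * d * d'') * edge_length
          + of_int (k * d * d') * pi = 0"
        using p(2) q(2) k(2) by (simp add: field_simps)
      from int_relation[OF this] show False
        using v p q k by auto
    qed
  qed auto
  from linear_independent_extend[OF this, of "\<lambda>x. if x = edge_length then a else if x = dihedral_angle then b else 0"]
  obtain f where f: "Vector_Spaces.linear ?s ?s f" "f dihedral_angle = b" "f edge_length = a" "f pi = 0"
    using ne by auto
  interpret f: Vector_Spaces.linear ?s ?s f by fact
  show thesis using that[of f] f f.add by blast
qed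

section \<open>Angles of arcs\<close>

definition circle_pt :: "real \<Rightarrow> real ^ 2" where
  "circle_pt t = vector [cos t, sin t]"

lemma circle_pt_nth [simp]: "circle_pt t $ 1 = cos t" "circle_pt t $ 2 = sin t"
  by (simp_all add: circle_pt_def)

text \<open>The determinant of the pair; its sign gives the orientation and will describe cones by
  inequalities.\<close>

definition area_form :: "real ^ 2 \<Rightarrow> real ^ 2 \<Rightarrow> real" where
  "area_form x y = x $ 1 * y $ 2 - x $ 2 * y $ 1"

lemma area_form_circle: "area_form (circle_pt s) (circle_pt t) = sin (t - s)"
  by (simp add: area_form_def sin_diff mult.commute)

lemma sphere_2_iff: "x \<in> sphere 0 1 \<longleftrightarrow> (x $ 1)\<^sup>2 + (x $ 2)\<^sup>2 = 1" for x :: "real ^ 2"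
  by (simp add: norm_eq_1 inner_vec_def sum_2 power2_eq_square)

lemma sphere_2E:
  fixes x :: "real ^ 2"
  assumes "x \<in> sphere 0 1"
  obtains t where "0 \<le> t" "t < 2 * pi" "x = circle_pt t"
proof -
  obtain t where "0 \<le> t" "t < 2 * pi" "x $ 1 = cos t" "x $ 2 = sin t"
    using sincos_total_2pi assms unfolding sphere_2_iff by metis
  then show thesis by (intro that[of t]) (auto simp: vec_eq_iff forall_2)
qed

lemma circle_pt_inj: "inj_on circle_pt {0..<2*pi}"
proof (rule inj_onI)
  fix s t assume *: "s \<in> {0..<2*pi}" "t \<in> {0..<2*pi}" "circle_pt s = circle_pt t"
  then have "cos s = cos t" "sin s = sin t" by (metis circle_pt_nth)+
  then have "sin s = sin t \<and> cos s = cos t" by simp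
  then obtain n :: int where n: "s = t + 2 * pi * n" using sin_cos_eq_iff by blast
  have "2 * pi * of_int n < 2 * pi * 1" "2 * pi * (-1) < 2 * pi * of_int n"
    using n *(1,2) unfolding atLeastLessThan_iff by linarith+
  then have "of_int n < (1::real)" "(-1::real) < of_int n"
    unfolding mult_less_cancel_left_pos[OF pi_gt_zero[THEN mult_pos_pos[OF zero_less_numeral]]] by auto
  then have "n = 0" by linarith
  then show "s = t" using n by simp
qed

text \<open>Cramer's rule in the plane, in a division-free form that is a polynomial
  identity.\<close>

lemma basis_expansion_2:
  "area_form u v *\<^sub>R x = area_form x v *\<^sub>R u + area_form u x *\<^sub>R v"
  by (simp add: vec_eq_iff forall_2 area_form_def algebra_simps)

lemma basis_expansion_2':
  assumes "area_form u v > 0"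
  shows "x = (area_form x v / area_form u v) *\<^sub>R u + (area_form u x / area_form u v) *\<^sub>R v"
proof -
  have "x = (1 / area_form u v) *\<^sub>R (area_form u v *\<^sub>R x)" using assms by simp
  also have "\<dots> = (1 / area_form u v) *\<^sub>R (area_form x v *\<^sub>R u + area_form u x *\<^sub>R v)"
    by (rule arg_cong[OF basis_expansion_2])
  finally show ?thesis by (simp add: scaleR_add_right)
qed

text \<open>By Cramer's rule the two determinants are, up to the positive factor
  \<open>area_form u v\<close>, the coordinates of \<open>x\<close> in the basis \<open>u\<close>,
  \<open>v\<close>.\<close>

lemma convex_cone_hull_pair:
  fixes u v :: "real ^ 2"
  assumes "area_form u v > 0"
  shows "convex_cone hull {u, v} = {x. area_form x v \<ge> 0 \<and> area_form u x \<ge> 0}" (is "_ = ?C")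
proof
  have "area_form u u = 0" "area_form v v = 0" by (simp_all add: area_form_def)
  then have "{u, v} \<subseteq> ?C" using assms by auto
  moreover have "convex_cone ?C"
  proof (unfold convex_cone_iff, intro conjI ballI allI impI)
    show "0 \<in> ?C" by (simp add: area_form_def)
    fix x y assume xy: "x \<in> ?C" "y \<in> ?C"
    have "area_form (x + y) v = area_form x v + area_form y v"
      "area_form u (x + y) = area_form u x + area_form u y"
      by (simp_all add: area_form_def algebra_simps)
    then show "x + y \<in> ?C" using xy by simp
  next
    fix x and c :: real assume xc: "x \<in> ?C" "c \<ge> 0"
    have "area_form (c *\<^sub>R x) v = c * area_form x v" "area_form u (c *\<^sub>R x) = c * area_form u x"
      by (simp_all add: area_form_def algebra_simps)
    then show "c *\<^sub>R x \<in> ?C" using xc by simp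
  qed
  ultimately show "convex_cone hull {u, v} \<subseteq> ?C" by (rule hull_minimal)
next
  show "?C \<subseteq> convex_cone hull {u, v}"
  proof
    fix x assume x: "x \<in> ?C"
    have "x = (area_form x v / area_form u v) *\<^sub>R u + (area_form u x / area_form u v) *\<^sub>R v"
      using assms by (rule basis_expansion_2')
    also have "\<dots> \<in> convex_cone hull {u, v}"
      using x assms by (intro convex_cone_hull_add convex_cone_hull_mul hull_inc) auto
    finally show "x \<in> convex_cone hull {u, v}" .
  qed
qed

text \<open>Listing the vertices in positive orientation makes the sine of the angle from the first
  to the second positive, hence that angle less than pi. The end \<open>s + d\<close> may exceed a
  full turn.\<close>

lemma simplices_2E:
  fixes B :: "(real ^ 2) set"
  assumes "B \<in> simplices"
  obtains s d where "0 \<le> s" "s < 2 * pi" "0 < d" "d < pi" "B = {circle_pt s, circle_pt (s + d)}"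
proof -
  have B: "B \<subseteq> sphere 0 1" "independent B" "card B = 2" using assms unfolding simplices_def by simp_all
  obtain u' v' where uv': "B = {u', v'}" "u' \<noteq> v'" using B(3) unfolding card_2_iff by (elim exE conjE) (rule that)
  have "area_form u' v' \<noteq> 0"
  proof
    assume 0: "area_form u' v' = 0"
    have "u' \<noteq> 0" using B(1) uv' by auto
    have "(u' \<bullet> u') *\<^sub>R v' = (u' \<bullet> v') *\<^sub>R u'"
      using 0 by (simp add: vec_eq_iff forall_2 inner_vec_def sum_2 area_form_def algebra_simps)
    then have "(1 / (u' \<bullet> u')) *\<^sub>R (u' \<bullet> u') *\<^sub>R v' = (1 / (u' \<bullet> u')) *\<^sub>R (u' \<bullet> v') *\<^sub>R u'" by simp
    then have "v' = ((u' \<bullet> v') / (u' \<bullet> u')) *\<^sub>R u'" using \<open>u' \<noteq> 0\<close> by simp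
    then have "v' \<in> span {u'}" using span_scale[OF span_base[of u' "{u'}"]] by (metis singletonI)
    moreover have "B - {v'} = {u'}" using uv' by auto
    ultimately show False using B(2) uv' unfolding dependent_def by (metis insertCI)
  qed
  then obtain u v where uv: "B = {u, v}" "area_form u v > 0"
  proof (cases "area_form u' v' > 0")
    case False
    have "area_form v' u' = - area_form u' v'" by (simp add: area_form_def)
    then have "area_form v' u' > 0" using False \<open>area_form u' v' \<noteq> 0\<close> by linarith
    moreover have "B = {v', u'}" using uv' by (simp add: insert_commute)
    ultimately show thesis by (rule that[rotated])
  qed (use uv' that in blast)
  have uvs: "u \<in> sphere 0 1" "v \<in> sphere 0 1" using B uv by auto
  obtain s where s: "0 \<le> s" "s < 2 * pi" "u = circle_pt s" using sphere_2E[OF uvs(1)] .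
  obtain t where t: "0 \<le> t" "t < 2 * pi" "v = circle_pt t" using sphere_2E[OF uvs(2)] .
  have pos: "sin (t - s) > 0" using uv(2) s t by (simp add: area_form_circle)
  show thesis
  proof (cases "s < t")
    case True
    have "t - s < pi" using sin_le_zero[of "t - s"] pos s t by force
    then show thesis using that[of s "t - s"] s t uv True by auto
  next
    case False
    \<comment> \<open>Here the arc runs through angle 0, so a full turn is added to its end.\<close>
    have "sin (t - s + 2 * pi) > 0" using pos by simp
    then have "t - s + 2 * pi < pi" using sin_le_zero[of "t - s + 2 * pi"] s t False by force
    moreover have "circle_pt (s + (t - s + 2 * pi)) = circle_pt t"
      by (simp add: circle_pt_def)
    ultimately show thesis using that[of s "t - s + 2 * pi"] s t uv by auto
  qed
qed

section \<open>Arc length as Lebesgue measure\<close>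

definition angle_set :: "(real ^ 2) set \<Rightarrow> real set" where
  "angle_set A = {t. 0 \<le> t \<and> t < 2 * pi \<and> circle_pt t \<in> A}"

lemma circle_pt_sphere: "circle_pt t \<in> sphere 0 1"
  unfolding sphere_2_iff by simp

lemma geodesic_simplex_circle:
  assumes "0 < d" "d < pi"
  shows "geodesic_simplex {circle_pt s, circle_pt (s + d)} =
    {x \<in> sphere 0 1. area_form x (circle_pt (s + d)) \<ge> 0 \<and> area_form (circle_pt s) x \<ge> 0}"
  using convex_cone_hull_pair[of "circle_pt s" "circle_pt (s + d)"] assms
  by (auto simp: geodesic_simplex_def area_form_circle sin_gt_zero)

lemma angle_set_arc:
  assumes s: "0 \<le> s" "s < 2 * pi" and d: "0 < d" "d < pi"
  shows "angle_set (geodesic_simplex {circle_pt s, circle_pt (s + d)}) =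
    (if s + d < 2 * pi then {s..s + d} else {s..<2 * pi} \<union> {0..s + d - 2 * pi})" (is "?L = ?R")
proof -
  have mem: "t \<in> ?L \<longleftrightarrow> 0 \<le> t \<and> t < 2 * pi \<and> sin (s + d - t) \<ge> 0 \<and> sin (t - s) \<ge> 0" for t
    unfolding angle_set_def geodesic_simplex_circle[OF d] mem_Collect_eq area_form_circle
    using circle_pt_sphere[of t] by blast
  \<comment> \<open>The range contains both arguments that occur, \<open>s + d - t\<close> and
    \<open>t - s\<close>; the outer two alternatives are the neighbouring half-waves of the
    sine.\<close>
  have pos: "sin x \<ge> 0 \<longleftrightarrow> x \<le> - pi \<or> 0 \<le> x \<and> x \<le> pi \<or> 2 * pi \<le> x"
    if "-2 * pi \<le> x" "x < 3 * pi" for x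
  proof -
    consider "x \<le> -pi" | "-pi < x" "x < 0" | "0 \<le> x" "x \<le> pi" | "pi < x" "x < 2 * pi" | "2 * pi \<le> x"
      by linarith
    then show ?thesis
    proof cases
      case 1
      then have "sin (x + 2 * pi) \<ge> 0" using that by (intro sin_ge_zero) linarith+
      then show ?thesis using 1 by simp
    next
      case 2
      then have "sin (- x) > 0" by (intro sin_gt_zero) linarith+
      moreover have "\<not> (x \<le> - pi \<or> 0 \<le> x \<and> x \<le> pi \<or> 2 * pi \<le> x)" using 2 pi_gt_zero by linarith
      ultimately show ?thesis by simp
    next
      case 3
      then have "sin x \<ge> 0" by (rule sin_ge_zero)
      then show ?thesis using 3 by blast
    next
      case 4
      then have "sin x < 0" by (rule sin_lt_zero)
      moreover have "\<not> (x \<le> - pi \<or> 0 \<le> x \<and> x \<le> pi \<or> 2 * pi \<le> x)" using 4 pi_gt_zero by linarith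
      ultimately show ?thesis by linarith
    next
      case 5
      then have "sin (x - 2 * pi) \<ge> 0" using that by (intro sin_ge_zero) linarith+
      then show ?thesis using 5 sin_periodic[of "x - 2 * pi"] by simp
    qed
  qed
  have lin: "(s + d - t \<le> - p \<or> 0 \<le> s + d - t \<and> s + d - t \<le> p \<or> 2 * p \<le> s + d - t) \<and>
      (t - s \<le> - p \<or> 0 \<le> t - s \<and> t - s \<le> p \<or> 2 * p \<le> t - s) \<longleftrightarrow>
      (if s + d < 2 * p then s \<le> t \<and> t \<le> s + d else s \<le> t \<and> t < 2 * p \<or> 0 \<le> t \<and> t \<le> s + d - 2 * p)"
    if "0 \<le> t" "t < 2 * p" "s < 2 * p" "d < p" for p t
    using that s(1) d(1) by (cases "s + d < 2 * p"; cases "s \<le> t"; simp; linarith)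
  show ?thesis
  proof (rule Set.set_eqI)
    fix t
    show "t \<in> ?L \<longleftrightarrow> t \<in> ?R"
    proof (cases "0 \<le> t \<and> t < 2 * pi")
      case True
      then show ?thesis
        using lin[of t pi] mem[of t] pos[of "s + d - t"] pos[of "t - s"] s d
        by (simp split del: if_split) (simp split: if_splits)
    next
      case False
      then have "t \<notin> ?L" using mem[of t] by blast
      moreover have "t \<notin> ?R"
        using False s d by (cases "s + d < 2 * pi"; simp only: if_True if_False Un_iff atLeastAtMost_iff atLeastLessThan_iff; linarith)
      ultimately show ?thesis by blast
    qed
  qed
qed

lemma angle_set_measure:
  fixes B :: "(real ^ 2) set"
  assumes "B = {circle_pt s, circle_pt (s + d)}" "0 \<le> s" "s < 2 * pi" "0 < d" "d < pi"
  shows "angle_set (geodesic_simplex B) \<in> lmeasurable"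
    "measure lebesgue (angle_set (geodesic_simplex B)) = d"
proof -
  have "{s..<2 * pi} \<union> {0..s + d - 2 * pi} \<in> lmeasurable"
    by (intro fmeasurable.Un bounded_set_imp_lmeasurable) auto
  then show "angle_set (geodesic_simplex B) \<in> lmeasurable"
    unfolding assms(1) angle_set_arc[OF assms(2-)] by auto
  show "measure lebesgue (angle_set (geodesic_simplex B)) = d"
  proof (cases "s + d < 2 * pi")
    case True
    then show ?thesis unfolding assms(1) angle_set_arc[OF assms(2-)] using assms by simp
  next
    case False
    have disj: "{s..<2 * pi} \<inter> {0..s + d - 2 * pi} = {}" using assms by auto
    have "{s..<2 * pi} \<in> lmeasurable" by (rule bounded_set_imp_lmeasurable) auto
    then have "measure lebesgue ({s..<2 * pi} \<union> {0..s + d - 2 * pi})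
        = measure lebesgue {s..<2 * pi} + measure lebesgue {0..s + d - 2 * pi}"
      using measure_Un3[of "{s..<2 * pi}" lebesgue "{0..s + d - 2 * pi}"] disj
      by (simp del: measure_lborel_Icc split del: if_split)
    also have "\<dots> = d" using False assms by simp
    \<comment> \<open>The two pieces of a wrapped arc have lengths 2 pi - s and s + d - 2
      pi.\<close>
    finally show ?thesis unfolding assms(1) angle_set_arc[OF assms(2-)] using False by simp
  qed
qed

text \<open>Taking a measure rather than an arccosine makes additivity over a subdivision an
  instance of finite additivity; the arcs need not be put in order along the circle.\<close>

definition arc_angle :: "(real ^ 2) set \<Rightarrow> real" where
  "arc_angle B = measure lebesgue (angle_set (geodesic_simplex B))"

text \<open>Removes the dependence on where the parametrization starts: orthogonal invariance and
  the right angles of suspensions are read off from the inner product.\<close>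

lemma arc_angle_eq:
  fixes u v :: "real ^ 2"
  assumes "{u, v} \<in> simplices"
  shows "arc_angle {u, v} = arccos (u \<bullet> v)"
proof -
  obtain s d where sd: "0 \<le> s" "s < 2 * pi" "0 < d" "d < pi" "{u, v} = {circle_pt s, circle_pt (s + d)}"
    using simplices_2E[OF assms] .
  have "circle_pt s \<bullet> circle_pt (s + d) = cos (s + d - s)"
    by (simp only: cos_diff) (simp add: inner_vec_def sum_2 mult.commute)
  then have "u \<bullet> v = cos d" using sd(5) by (auto simp: doubleton_eq_iff inner_commute)
  then have "arccos (u \<bullet> v) = d" using sd by (simp add: arccos_cos)
  then show ?thesis using angle_set_measure(2)[OF sd(5,1-4)] by (simp add: arc_angle_def)
qed

text \<open>Away from the endpoints both determinants are strictly positive, which is an open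
  condition.\<close>

lemma geodesic_simplex_interior_2:
  fixes B :: "(real ^ 2) set"
  assumes "B \<in> simplices"
  shows "geodesic_simplex B - B \<subseteq> top_of_set (sphere 0 1) interior_of geodesic_simplex B"
proof -
  obtain s d where sd: "0 \<le> s" "s < 2 * pi" "0 < d" "d < pi" and B: "B = {circle_pt s, circle_pt (s + d)}"
    using simplices_2E[OF assms] .
  let ?u = "circle_pt s" and ?v = "circle_pt (s + d)"
  let ?O = "sphere 0 1 \<inter> {x. 0 < area_form x ?v \<and> 0 < area_form ?u x}"
  have uv: "area_form ?u ?v > 0" using sd by (simp add: area_form_circle sin_gt_zero)
  have "open {x. 0 < area_form x ?v \<and> 0 < area_form ?u x}"
    unfolding area_form_def by (intro open_Collect_conj open_Collect_less continuous_intros)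
  then have "openin (top_of_set (sphere 0 1)) ?O" by blast
  moreover have "?O \<subseteq> geodesic_simplex B"
    unfolding B geodesic_simplex_circle[OF sd(3,4)] by auto
  ultimately have "?O \<subseteq> top_of_set (sphere 0 1) interior_of geodesic_simplex B"
    by (rule interior_of_maximal[rotated])
  moreover have "geodesic_simplex B - B \<subseteq> ?O"
  proof
    fix x assume x: "x \<in> geodesic_simplex B - B"
    have xs: "norm x = 1" "area_form x ?v \<ge> 0" "area_form ?u x \<ge> 0" "x \<noteq> ?u" "x \<noteq> ?v"
      using x unfolding B geodesic_simplex_circle[OF sd(3,4)] by auto
    have n: "norm ?u = 1" "norm ?v = 1" using circle_pt_sphere by (simp_all add: dist_norm)
    have e: "x = (area_form x ?v / area_form ?u ?v) *\<^sub>R ?u + (area_form ?u x / area_form ?u ?v) *\<^sub>R ?v"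
      using uv by (rule basis_expansion_2')
    \<comment> \<open>Otherwise \<open>x\<close> would be a nonnegative multiple of
      \<open>?v\<close> of norm 1, hence \<open>?v\<close> itself.\<close>
    have "area_form x ?v \<noteq> 0"
    proof
      assume 0: "area_form x ?v = 0"
      then have "x = (area_form ?u x / area_form ?u ?v) *\<^sub>R ?v" using e by simp
      moreover from this have "\<bar>area_form ?u x / area_form ?u ?v\<bar> = 1"
        using xs n by (metis norm_scaleR mult.right_neutral)
      moreover have "area_form ?u x / area_form ?u ?v \<ge> 0" using xs uv by simp
      ultimately show False using xs by (simp only: abs_of_nonneg scaleR_one)
    qed
    moreover have "area_form ?u x \<noteq> 0"
    proof
      assume 0: "area_form ?u x = 0"
      then have "x = (area_form x ?v / area_form ?u ?v) *\<^sub>R ?u" using e by simp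
      moreover from this have "\<bar>area_form x ?v / area_form ?u ?v\<bar> = 1"
        using xs n by (metis norm_scaleR mult.right_neutral)
      moreover have "area_form x ?v / area_form ?u ?v \<ge> 0" using xs uv by simp
      ultimately show False using xs by (simp only: abs_of_nonneg scaleR_one)
    qed
    ultimately show "x \<in> ?O" using xs by auto
  qed
  ultimately show ?thesis by blast
qed

lemma finite_angle_set: "finite A \<Longrightarrow> finite (angle_set A)"
  unfolding angle_set_def
  by (rule finite_subset[OF _ finite_vimage_IntI[OF _ circle_pt_inj]]) auto

lemma arc_angle_subdivides:
  fixes P :: "(real ^ 2) set"
  assumes "subdivides \<Q> P"
  shows "arc_angle P = (\<Sum>Q\<in>\<Q>. arc_angle Q)"
proof -
  have Q: "finite \<Q>" "\<Q> \<subseteq> simplices" "geodesic_simplex P = (\<Union>Q\<in>\<Q>. geodesic_simplex Q)"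
    and disj: "pairwise (\<lambda>Q Q'. disjnt (top_of_set (sphere 0 1) interior_of geodesic_simplex Q)
                             (top_of_set (sphere 0 1) interior_of geodesic_simplex Q')) \<Q>"
    using assms by (auto simp: subdivides_def)
  have "angle_set (geodesic_simplex P) = (\<Union>Q\<in>\<Q>. angle_set (geodesic_simplex Q))"
    unfolding Q(3) by (auto simp: angle_set_def)
  moreover have "measure lebesgue (\<Union>Q\<in>\<Q>. angle_set (geodesic_simplex Q)) = (\<Sum>Q\<in>\<Q>. arc_angle Q)"
    unfolding arc_angle_def
  proof (rule measure_negligible_finite_Union_image[OF Q(1)])
    fix Q assume "Q \<in> \<Q>"
    then have "Q \<in> simplices" using Q by auto
    then show "angle_set (geodesic_simplex Q) \<in> lmeasurable"
      using simplices_2E angle_set_measure(1) by metis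
  next
    show "pairwise (\<lambda>Q Q'. negligible (angle_set (geodesic_simplex Q) \<inter> angle_set (geodesic_simplex Q'))) \<Q>"
    proof (rule pairwiseI)
      fix Q Q' assume *: "Q \<in> \<Q>" "Q' \<in> \<Q>" "Q \<noteq> Q'"
      then have s: "Q \<in> simplices" "Q' \<in> simplices" using Q by auto
      \<comment> \<open>A common point that is a vertex of neither arc would lie in both interiors.
        So overlaps are finite, hence null sets.\<close>
      have "geodesic_simplex Q \<inter> geodesic_simplex Q' \<subseteq> Q \<union> Q'"
        using geodesic_simplex_interior_2[OF s(1)] geodesic_simplex_interior_2[OF s(2)] disj *
        unfolding pairwise_def disjnt_def by blast
      then have "angle_set (geodesic_simplex Q) \<inter> angle_set (geodesic_simplex Q') \<subseteq> angle_set (Q \<union> Q')"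
        unfolding angle_set_def by blast
      moreover have "finite (Q \<union> Q')" using s independent_imp_finite by (auto simp: simplices_def)
      ultimately show "negligible (angle_set (geodesic_simplex Q) \<inter> angle_set (geodesic_simplex Q'))"
        using finite_angle_set finite_subset negligible_finite by metis
    qed
  qed
  ultimately show ?thesis by (simp add: arc_angle_def)
qed

section \<open>Dihedral angles\<close>

lemma orth_proj_unique:
  fixes W :: "'a::euclidean_space set"
  assumes "subspace W" "y \<in> W" "x - y \<in> W\<^sup>\<bottom>"
  shows "orth_proj W x = y"
proof -
  have p: "orth_proj W x \<in> W" "x - orth_proj W x \<in> W\<^sup>\<bottom>" using orth_proj[OF assms(1)] by auto
  have "orth_proj W x - y \<in> W" using p assms by (intro subspace_diff)
  moreover have "(x - y) - (x - orth_proj W x) \<in> W\<^sup>\<bottom>"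
    by (rule subspace_diff[OF subspace_orthogonal_comp assms(3) p(2)])
  ultimately have "orthogonal (orth_proj W x - y) (orth_proj W x - y)"
    by (auto simp: orthogonal_comp_def)
  then show ?thesis by (simp add: orthogonal_def)
qed

lemma span_orthogonal_comp_iff:
  "x \<in> (span S)\<^sup>\<bottom> \<longleftrightarrow> (\<forall>s\<in>S. s \<bullet> x = 0)"
proof
  assume "\<forall>s\<in>S. s \<bullet> x = 0"
  then have "orthogonal x y" if "y \<in> span S" for y
    using orthogonal_to_span[OF that, of x] by (simp add: orthogonal_def inner_commute)
  then show "x \<in> (span S)\<^sup>\<bottom>"
    by (auto simp: orthogonal_comp_def orthogonal_commute)
qed (auto simp: orthogonal_comp_def orthogonal_def span_base)

text \<open>Up to positive factors \<open>m\<close> and \<open>n\<close> are dual basis vectors,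
  that is, inner normals of the facets opposite \<open>k\<close> and \<open>l\<close>. They span the
  plane orthogonal to \<open>B - {k, l}\<close>.\<close>

context
  fixes B :: "'a::euclidean_space set" and k l m n :: 'a
  assumes B: "independent B" "span B = UNIV" and kl: "k \<in> B" "l \<in> B" "k \<noteq> l"
    and m: "m \<bullet> k > 0" "\<And>x. x \<in> B \<Longrightarrow> x \<noteq> k \<Longrightarrow> m \<bullet> x = 0"
    and n: "n \<bullet> l > 0" "\<And>x. x \<in> B \<Longrightarrow> x \<noteq> l \<Longrightarrow> n \<bullet> x = 0"
begin

definition "gram_det = (m \<bullet> m) * (n \<bullet> n) - (m \<bullet> n)\<^sup>2"

text \<open>Strict Cauchy-Schwarz: parallel normals are impossible, because \<open>n\<close> is
  orthogonal to \<open>k\<close> and \<open>m\<close> is not.\<close>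

lemma gram_det_pos: "gram_det > 0"
proof -
  have "m \<noteq> 0" "n \<noteq> 0" using m(1) n(1) by auto
  have "\<bar>m \<bullet> n\<bar> \<noteq> norm m * norm n"
  proof
    assume "\<bar>m \<bullet> n\<bar> = norm m * norm n"
    then have "norm m *\<^sub>R n = norm n *\<^sub>R m \<or> norm m *\<^sub>R n = - norm n *\<^sub>R m"
      using norm_cauchy_schwarz_abs_eq by blast
    then have "(norm m *\<^sub>R n) \<bullet> k = norm n * (m \<bullet> k) \<or> (norm m *\<^sub>R n) \<bullet> k = - (norm n * (m \<bullet> k))"
      by (metis inner_minus_left inner_scaleR_left mult_minus_left)
    moreover have "n \<bullet> k = 0" using n(2) kl by auto
    ultimately show False using m(1) \<open>n \<noteq> 0\<close> by auto
  qed
  then have "\<bar>m \<bullet> n\<bar> < norm m * norm n" using Cauchy_Schwarz_ineq2[of m n] by linarith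
  then have "\<bar>m \<bullet> n\<bar>\<^sup>2 < (norm m * norm n)\<^sup>2" by (intro power_strict_mono) auto
  then show ?thesis by (simp add: gram_det_def power_mult_distrib power2_norm_eq_inner)
qed

text \<open>The projection lies in the plane of \<open>m\<close> and \<open>n\<close> and has the
  same inner products with them as \<open>k\<close>, namely \<open>m \<bullet> k\<close> and 0;
  solving this Gram system gives the formula.\<close>

lemma orth_proj_dual_pair:
  "orth_proj ((span (B - {k, l}))\<^sup>\<bottom>) k = ((m \<bullet> k) / gram_det) *\<^sub>R ((n \<bullet> n) *\<^sub>R m - (m \<bullet> n) *\<^sub>R n)"
    (is "_ = ?y")
proof (rule orth_proj_unique[OF subspace_orthogonal_comp])
  let ?S = "B - {k, l}"
  show "?y \<in> (span ?S)\<^sup>\<bottom>"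
    unfolding span_orthogonal_comp_iff using m(2) n(2) by (auto simp: inner_diff_right inner_commute)
  have mn: "m \<bullet> l = 0" "n \<bullet> k = 0" using m(2) n(2) kl by auto
  have "m \<bullet> ?y = ((m \<bullet> k) / gram_det) * gram_det"
    by (simp add: inner_diff_right gram_det_def power2_eq_square mult.commute)
  then have my: "m \<bullet> (k - ?y) = 0" using gram_det_pos by (simp add: inner_diff_right)
  have "n \<bullet> ?y = ((m \<bullet> k) / gram_det) * 0"
    by (simp only: inner_diff_right inner_scaleR_right inner_commute[of n m]) simp
  then have ny: "n \<bullet> (k - ?y) = 0" using mn by (simp add: inner_diff_right)
  have "B = insert k (insert l ?S)" using kl by auto
  \<comment> \<open>Expanded in the basis \<open>B\<close>, the difference loses its coefficients at
    \<open>k\<close> and \<open>l\<close> by pairing with \<open>m\<close> and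
    \<open>n\<close>.\<close>
  then have "k - ?y \<in> span (insert k (insert l ?S))" using B(2) by auto
  then obtain a b where "k - ?y - a *\<^sub>R k - b *\<^sub>R l \<in> span ?S" unfolding span_insert by auto
  then obtain s where s: "s \<in> span ?S" "k - ?y = a *\<^sub>R k + b *\<^sub>R l + s"
    by (metis (no_types, lifting) add.commute diff_add_cancel diff_diff_eq)
  have "orthogonal m s" "orthogonal n s"
    using s(1) by (rule orthogonal_to_span; use m(2) n(2) in \<open>simp add: orthogonal_def\<close>)+
  then have "a = 0" "b = 0"
    using my ny mn m(1) n(1) unfolding s(2) by (simp_all add: inner_add_right orthogonal_def)
  then have "k - ?y \<in> span ?S" using s by simp
  then show "k - ?y \<in> (span ?S)\<^sup>\<bottom>\<^sup>\<bottom>" using orthogonal_comp_subset by blast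
qed

end

text \<open>In the projection plane the image of \<open>k\<close> is perpendicular to
  \<open>n\<close> and that of \<open>l\<close> to \<open>m\<close>, which makes their angle the
  supplement of the angle between the normals. Dihedral angles thus follow from normals
  alone.\<close>

lemma orth_proj_dual_angle:
  fixes B :: "'a::euclidean_space set" and k l m n :: 'a
  assumes B: "independent B" "span B = UNIV" and kl: "k \<in> B" "l \<in> B" "k \<noteq> l"
    and m: "m \<bullet> k > 0" "\<And>x. x \<in> B \<Longrightarrow> x \<noteq> k \<Longrightarrow> m \<bullet> x = 0"
    and n: "n \<bullet> l > 0" "\<And>x. x \<in> B \<Longrightarrow> x \<noteq> l \<Longrightarrow> n \<bullet> x = 0"
  defines "P \<equiv> orth_proj ((span (B - {k, l}))\<^sup>\<bottom>)"
  shows "independent {P k, P l}" "P k \<noteq> P l" "sgn (P k) \<bullet> sgn (P l) = - (m \<bullet> n) / (norm m * norm n)"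
proof -
  define g where "g = (m \<bullet> m) * (n \<bullet> n) - (m \<bullet> n)\<^sup>2"
  have g: "g > 0" "gram_det m n = g" "gram_det n m = g"
    using gram_det_pos[OF B kl m n] gram_det_def[OF B kl m n] gram_det_def[OF B kl(2,1) kl(3)[symmetric] n m]
    by (simp_all add: g_def inner_commute mult.commute)
  define y z where "y = (n \<bullet> n) *\<^sub>R m - (m \<bullet> n) *\<^sub>R n" and "z = (m \<bullet> m) *\<^sub>R n - (m \<bullet> n) *\<^sub>R m"
  have P: "P k = ((m \<bullet> k) / g) *\<^sub>R y" "P l = ((n \<bullet> l) / g) *\<^sub>R z"
    using orth_proj_dual_pair[OF B kl m n] orth_proj_dual_pair[OF B kl(2,1) kl(3)[symmetric] n m]
    by (simp_all add: P_def g y_def z_def inner_commute insert_commute)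
  have mn: "m \<noteq> 0" "n \<noteq> 0" using m(1) n(1) by auto
  \<comment> \<open>Up to the factor \<open>sqrt g\<close>, the vectors \<open>y\<close> and
    \<open>z\<close> have the lengths of \<open>n\<close> and \<open>m\<close>, while their inner
    product changes sign.\<close>
  have yy: "y \<bullet> y = (n \<bullet> n) * g" and zz: "z \<bullet> z = (m \<bullet> m) * g" and yz: "y \<bullet> z = - (m \<bullet> n) * g"
    by (simp_all add: y_def z_def g_def inner_commute power2_eq_square algebra_simps)
  have ny: "norm y = norm n * sqrt g" and nz: "norm z = norm m * sqrt g"
    unfolding norm_eq_sqrt_inner yy zz by (simp_all add: real_sqrt_mult)
  have sg: "sgn (P k) = sgn y" "sgn (P l) = sgn z"
    using P g(1) m(1) n(1) by (simp_all add: sgn_scaleR)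
  have "sgn y \<bullet> sgn z = (y \<bullet> z) / (norm y * norm z)"
    by (simp add: sgn_div_norm divide_inverse)
  also have "\<dots> = - (m \<bullet> n) / (norm m * norm n)"
    using g(1) mn unfolding yz ny nz by (simp add: field_simps)
  finally show "sgn (P k) \<bullet> sgn (P l) = - (m \<bullet> n) / (norm m * norm n)" using sg by simp
  have my: "m \<bullet> y = g" "m \<bullet> z = 0" "n \<bullet> z = g" "n \<bullet> y = 0"
    by (simp_all add: y_def z_def g_def inner_commute power2_eq_square algebra_simps)
  have mp: "m \<bullet> P k > 0" "m \<bullet> P l = 0" "n \<bullet> P l > 0"
    using P my m(1) n(1) g(1) by simp_all
  then show "P k \<noteq> P l" by auto
  have "P k \<notin> span {P l}"
    using mp by (auto simp: span_singleton)
  moreover have "P l \<noteq> 0" using mp by auto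
  ultimately show "independent {P k, P l}" by (simp add: independent_insert)
qed

lemma independent_dual:
  assumes "\<And>v. v \<in> B \<Longrightarrow> \<exists>n. n \<bullet> v \<noteq> 0 \<and> (\<forall>w\<in>B - {v}. n \<bullet> w = 0)"
  shows "independent B"
proof
  assume "dependent B"
  then obtain v where v: "v \<in> B" "v \<in> span (B - {v})" unfolding dependent_def by blast
  obtain n where n: "n \<bullet> v \<noteq> 0" "\<forall>w\<in>B - {v}. n \<bullet> w = 0" using assms[OF v(1)] by blast
  have "orthogonal n v"
    using v(2) by (rule orthogonal_to_span) (use n in \<open>simp add: orthogonal_def\<close>)
  then show False using n(1) by (simp add: orthogonal_def)
qed

section \<open>The Dehn invariant of an orthoscheme\<close>

lemma angle_functional:
  fixes f :: "real \<Rightarrow> real"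
  assumes add: "\<And>x y. f (x + y) = f x + f y" and pi: "f pi = 0"
  obtains h :: "(real ^ 2) scissors_class \<Rightarrow> real" where "h \<in> hom scissors_group real_add_group"
    "\<And>u v. {u, v} \<in> simplices \<Longrightarrow> h (simplex_class {u, v}) = f (arccos (u \<bullet> v))"
proof -
  have f0: "f 0 = 0" using add[of 0 0] by simp
  have fsum: "f (sum g A) = (\<Sum>a\<in>A. f (g a))" if "finite A" for g :: "(real ^ 2) set \<Rightarrow> real" and A
    using that by (induction rule: finite_induct) (simp_all add: f0 add)
  have pair: "\<exists>u v. B = {u, v}" if "B \<in> simplices" for B :: "(real ^ 2) set"
  proof -
    have "card B = 2" using that by (simp add: simplices_def)
    then show ?thesis by (auto simp: card_2_iff)
  qed
  obtain h :: "(real ^ 2) scissors_class \<Rightarrow> real" where h: "h \<in> hom scissors_group real_add_group"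
      "\<And>B. B \<in> simplices \<Longrightarrow> h (simplex_class B) = f (arc_angle B)"
  proof (rule scissors_group_universal_real[of "\<lambda>B. f (arc_angle B)"])
    fix P :: "(real ^ 2) set" and \<Q> assume s: "subdivides \<Q> P"
    then have "finite \<Q>" by (simp add: subdivides_def)
    then show "f (arc_angle P) = (\<Sum>Q\<in>\<Q>. f (arc_angle Q))"
      unfolding arc_angle_subdivides[OF s] by (rule fsum)
  next
    fix v :: "real ^ 2" and B assume s: "susp_cond v B"
    then have "card B = 1" by simp
    then obtain b where b: "B = {b}" using card_1_singletonE by blast
    have "b \<bullet> v = 0" using s b by (simp add: span_orthogonal_comp_iff)
    moreover have "- v \<in> (span B)\<^sup>\<bottom>" using s by (simp add: subspace_neg subspace_orthogonal_comp)
    then have "{v, b} \<in> simplices" "{- v, b} \<in> simplices"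
      using s b insert_in_simplices[of B v] insert_in_simplices[of B "- v"] by auto
    ultimately have "f (arc_angle (insert v B)) + f (arc_angle (insert (- v) B)) = f (pi / 2 + pi / 2)"
      unfolding b add by (simp add: arc_angle_eq inner_commute)
    then show "f (arc_angle (insert v B)) + f (arc_angle (insert (- v) B)) = 0" using pi by simp
  next
    fix g :: "real ^ 2 \<Rightarrow> real ^ 2" and B :: "(real ^ 2) set"
    assume g: "orthogonal_transformation g" and B: "B \<in> simplices"
    obtain u v where uv: "B = {u, v}" using pair[OF B] by blast
    have "{g u, g v} \<in> simplices" using image_in_simplices[OF g B] uv by simp
    then show "f (arc_angle (g ` B)) = f (arc_angle B)"
      using B g unfolding uv by (simp add: arc_angle_eq orthogonal_transformation_def)
  qed blast
  then show thesis by (intro that[of h]) (simp_all add: arc_angle_eq)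
qed

section \<open>Arc classes and inner products\<close>

lemma plane_isometry_inner:
  assumes "plane_isometry W p" "subspace W" "x \<in> W" "y \<in> W"
  shows "p x \<bullet> p y = x \<bullet> y"
proof -
  have "p (x + y) = p x + p y" using assms(1) by (simp add: plane_isometry_def linear_add)
  moreover have "x + y \<in> W" using assms by (simp add: subspace_add)
  ultimately have "norm (p x + p y) = norm (x + y)" "norm (p x) = norm x" "norm (p y) = norm y"
    using assms by (auto simp: plane_isometry_def)
  then show ?thesis by (simp add: dot_norm)
qed

text \<open>Hides the chosen isometry: an angle functional sees only the inner product of the
  normalized vertices, which isometries preserve.\<close>

lemma arc_class_simplex:
  fixes a b :: "'a::euclidean_space"
  assumes "independent {a, b}" "a \<noteq> b"
  obtains u v where "{u, v} \<in> simplices" "arc_class {a, b} = simplex_class {u, v}" "u \<bullet> v = sgn a \<bullet> sgn b"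
proof -
  have card: "card {a, b} = 2" using assms(2) by simp
  then have "dim (span {a, b}) = 2" using dim_eq_card_independent[OF assms(1)] by simp
  then obtain p where p: "plane_isometry (span {a, b}) p" using plane_isometry_exists by blast
  have "sgn a \<in> span {a, b}" "sgn b \<in> span {a, b}"
    by (simp_all add: sgn_div_norm span_base span_scale)
  then have "p (sgn a) \<bullet> p (sgn b) = sgn a \<bullet> sgn b"
    by (intro plane_isometry_inner[OF p]) auto
  then show thesis
    using arc_in_simplices[OF assms(1) card p] arc_class_eq[OF assms(1) card p]
    by (intro that[of "p (sgn a)" "p (sgn b)"]) simp_all
qed

text \<open>Pairing a linear relation among the \<open>v i\<close> with \<open>n i\<close> isolates
  one coefficient, so the normals certify that the vertices form a basis.\<close>

lemma dual_system_simplex: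
  fixes v n :: "nat \<Rightarrow> 'a::euclidean_space"
  assumes v: "\<And>i. i < DIM('a) \<Longrightarrow> norm (v i) = 1"
    and pos: "\<And>i. i < DIM('a) \<Longrightarrow> n i \<bullet> v i > 0"
    and zero: "\<And>i j. i < DIM('a) \<Longrightarrow> j < DIM('a) \<Longrightarrow> i \<noteq> j \<Longrightarrow> n i \<bullet> v j = 0"
  shows "inj_on v {..<DIM('a)}" "v ` {..<DIM('a)} \<in> simplices" "span (v ` {..<DIM('a)}) = UNIV"
proof -
  let ?B = "v ` {..<DIM('a)}"
  show inj: "inj_on v {..<DIM('a)}"
    by (rule inj_onI) (use pos zero in \<open>metis lessThan_iff less_irrefl\<close>)
  have ind: "independent ?B"
  proof (rule independent_dual)
    fix x assume "x \<in> ?B"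
    then obtain i where i: "i < DIM('a)" "x = v i" by auto
    then show "\<exists>n. n \<bullet> x \<noteq> 0 \<and> (\<forall>w\<in>?B - {x}. n \<bullet> w = 0)"
      using pos[OF i(1)] zero[OF i(1)] by (intro exI[of _ "n i"]) auto
  qed
  moreover have card: "card ?B = DIM('a)" using inj by (simp add: card_image)
  ultimately show "?B \<in> simplices" using v by (auto simp: simplices_def)
  show "span ?B = UNIV"
    using card_ge_dim_independent[of ?B UNIV] ind card by auto
qed

text \<open>The vertices span the same cone as the partial sums of the orthogonal vectors \<open>(15/4, 0, 0, 0)\<close>,
  \<open>(0, 3, 0, 0)\<close>, \<open>(0, 0, sqrt 41, 0)\<close>, \<open>(0, 0, 0, sqrt 41)\<close>.  The dihedral angle at an edge is
  the supplement of the angle between the inner normals of the two faces that contain it.\<close>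

definition vert :: "nat \<Rightarrow> real ^ 4" where
  "vert i = [vector [1, 0, 0, 0],
     vector [5 * sqrt 41 / 41, 4 * sqrt 41 / 41, 0, 0],
     vector [3 * sqrt 41 / 41, 12 * sqrt 41 / 205, 4 / 5, 0],
     vector [15 / 41, 12 / 41, 4 * sqrt 41 / 41, 4 * sqrt 41 / 41]] ! i"

text \<open>Inner normals of the facets opposite the vertices, scaled to clear denominators: for
  consecutive lengths a, b of the orthogonal vectors, the normal is proportional to 1/a, -1/b in the
  two coordinates concerned.\<close>

definition nrml :: "nat \<Rightarrow> real ^ 4" where
  "nrml i = [vector [4, -5, 0, 0], vector [0, sqrt 41, -3, 0], vector [0, 0, 1, -1], vector [0, 0, 0, 1]] ! i"

lemma vector_4_nth:
  "(vector [a, b, c, d] :: real ^ 4) $ 1 = a" "(vector [a, b, c, d] :: real ^ 4) $ 2 = b"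
  "(vector [a, b, c, d] :: real ^ 4) $ 3 = c" "(vector [a, b, c, d] :: real ^ 4) $ 4 = d"
  by (simp_all add: vector_def)

lemma inner_vector_4:
  "(vector [a, b, c, d] :: real ^ 4) \<bullet> vector [a', b', c', d'] = a * a' + b * b' + c * c' + d * d'"
  by (simp add: inner_vec_def sum_4 vector_4_nth)

lemma all_less_4: "(\<forall>i<4. P i) \<longleftrightarrow> P 0 \<and> P 1 \<and> P 2 \<and> P (3::nat)"
  by (auto simp: numeral_eq_Suc less_Suc_eq)

lemma nth_4: "[a, b, c, d] ! 0 = a" "[a, b, c, d] ! 1 = b" "[a, b, c, d] ! 2 = c" "[a, b, c, d] ! 3 = d"
  by simp_all

lemma vert_norm: "i < 4 \<Longrightarrow> norm (vert i) = 1"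
proof -
  have "\<forall>i<4. vert i \<bullet> vert i = 1"
    unfolding all_less_4 vert_def nth_4 inner_vector_4 by simp
  then show "i < 4 \<Longrightarrow> norm (vert i) = 1" by (simp add: norm_eq_1)
qed

lemma nrml_vert:
  "i < 4 \<Longrightarrow> nrml i \<bullet> vert i > 0"
  "i < 4 \<Longrightarrow> j < 4 \<Longrightarrow> i \<noteq> j \<Longrightarrow> nrml i \<bullet> vert j = 0"
proof -
  have "\<forall>i<4. nrml i \<bullet> vert i > 0"
    unfolding all_less_4 vert_def nrml_def nth_4 inner_vector_4 by simp
  then show "i < 4 \<Longrightarrow> nrml i \<bullet> vert i > 0" by blast
  have "\<forall>i<4. \<forall>j<4. i \<noteq> j \<longrightarrow> nrml i \<bullet> vert j = 0"
    unfolding all_less_4 vert_def nrml_def nth_4 inner_vector_4 by simp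
  then show "i < 4 \<Longrightarrow> j < 4 \<Longrightarrow> i \<noteq> j \<Longrightarrow> nrml i \<bullet> vert j = 0" by blast
qed

text \<open>Only consecutive normals share a coordinate, which gives the three right angles. The
  lengths are tuned for the rest: (1 + 16/25) (1 + 9/41) = 2 makes the pair 0, 1 meet at pi/4, the
  two equal last lengths do so for the pair 2, 3, and (1 + 41/9) * 2 = 100/9 yields 3/10.\<close>

lemma nrml_cos:
  assumes "i < 4" "j < 4" "i \<noteq> j"
  shows "- (nrml i \<bullet> nrml j) / (norm (nrml i) * norm (nrml j)) =
    (if {i, j} = {1, 2} then 3 / 10 else if {i, j} = {0, 1} \<or> {i, j} = {2, 3} then sqrt 2 / 2 else 0)"
proof -
  have s50: "sqrt 50 = 5 * sqrt 2" using real_sqrt_mult[of 25 2] by simp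
  have "\<forall>i<4. \<forall>j<4. i \<noteq> j \<longrightarrow> - (nrml i \<bullet> nrml j) / (norm (nrml i) * norm (nrml j)) =
    (if {i, j} = {1, 2} then 3 / 10 else if {i, j} = {0, 1} \<or> {i, j} = {2, 3} then sqrt 2 / 2 else 0)"
    unfolding all_less_4 norm_eq_sqrt_inner nrml_def nth_4 inner_vector_4
    by (simp add: doubleton_eq_iff s50 field_simps)
  then show ?thesis using assms by blast
qed

text \<open>The edge \<open>S\<close> is named by the two vertices it omits: the facets that contain
  it are those opposite \<open>vert i\<close> and \<open>vert j\<close>.\<close>

lemma angle_functional_dihedral:
  fixes f :: "real \<Rightarrow> real" and h :: "(real ^ 2) scissors_class \<Rightarrow> real"
  assumes add: "\<And>x y. f (x + y) = f x + f y" and pi: "f pi = 0"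
    and h: "\<And>u v. {u, v} \<in> simplices \<Longrightarrow> h (simplex_class {u, v}) = f (arccos (u \<bullet> v))"
    and B: "B = vert ` {..<4}" and ij: "i < 4" "j < 4" "i \<noteq> j" "B - S = {vert i, vert j}" "S \<subseteq> B"
  shows "arc_class (orth_proj ((span S)\<^sup>\<bottom>) ` (B - S)) \<in> carrier scissors_group"
    "h (arc_class (orth_proj ((span S)\<^sup>\<bottom>) ` (B - S))) = (if {i, j} = {1, 2} then f dihedral_angle else 0)"
proof -
  have dual: "inj_on vert {..<4}" "B \<in> simplices" "span B = UNIV"
    using dual_system_simplex[of vert nrml] vert_norm nrml_vert B by simp_all
  then have ind: "independent B" by (simp add: simplices_def)
  have S: "S = B - {vert i, vert j}" using ij by blast
  have mem: "vert i \<in> B" "vert j \<in> B" and ne: "vert i \<noteq> vert j"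
    using ij dual(1) unfolding B by (auto dest: inj_onD)
  have z: "nrml k \<bullet> x = 0" if "k < 4" "x \<in> B" "x \<noteq> vert k" for k x
    using that nrml_vert(2)[OF that(1)] unfolding B by auto
  let ?P = "orth_proj ((span S)\<^sup>\<bottom>)"
  have P: "independent {?P (vert i), ?P (vert j)}" "?P (vert i) \<noteq> ?P (vert j)"
    "sgn (?P (vert i)) \<bullet> sgn (?P (vert j)) = - (nrml i \<bullet> nrml j) / (norm (nrml i) * norm (nrml j))"
    using orth_proj_dual_angle[OF ind dual(3) mem ne nrml_vert(1)[OF ij(1)] z[OF ij(1)]
        nrml_vert(1)[OF ij(2)] z[OF ij(2)]] unfolding S by blast+
  obtain u v where uv: "{u, v} \<in> simplices" "arc_class {?P (vert i), ?P (vert j)} = simplex_class {u, v}"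
      "u \<bullet> v = sgn (?P (vert i)) \<bullet> sgn (?P (vert j))"
    using arc_class_simplex[OF P(1,2)] .
  have img: "?P ` (B - S) = {?P (vert i), ?P (vert j)}" unfolding ij(4) by simp
  show "arc_class (?P ` (B - S)) \<in> carrier scissors_group"
    unfolding img uv(2) by (rule simplex_class_closed[OF uv(1)])
  \<comment> \<open>The reals have no torsion, so \<open>f pi = 0\<close> passes to pi/2 and
    pi/4.\<close>
  have f2: "f (pi / 2) = 0" using add[of "pi / 2" "pi / 2"] pi by simp
  have f4: "f (pi / 4) = 0" using add[of "pi / 4" "pi / 4"] f2 by simp
  have "arccos (cos (pi / 4)) = pi / 4" by (rule arccos_cos) auto
  then have a4: "arccos (sqrt 2 / 2) = pi / 4" by (simp add: cos_45)
  show "h (arc_class (?P ` (B - S))) = (if {i, j} = {1, 2} then f dihedral_angle else 0)"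
    unfolding img uv(2) h[OF uv(1)] uv(3) P(3) nrml_cos[OF ij(1-3)]
    by (simp add: f2 f4 a4 dihedral_angle_def)
qed

text \<open>Kept general in \<open>f\<close> and \<open>g\<close> so that it evaluates the Dehn
  invariant both before and after the swap.\<close>

lemma orthoscheme_sum:
  fixes f g :: "real \<Rightarrow> real" and a b :: "(real ^ 2) scissors_class \<Rightarrow> real"
  assumes f: "\<And>x y. f (x + y) = f x + f y" "f pi = 0"
    and g: "\<And>x y. g (x + y) = g x + g y" "g pi = 0"
    and a: "\<And>u v. {u, v} \<in> simplices \<Longrightarrow> a (simplex_class {u, v}) = f (arccos (u \<bullet> v))"
    and b: "\<And>u v. {u, v} \<in> simplices \<Longrightarrow> b (simplex_class {u, v}) = g (arccos (u \<bullet> v))"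
    and B: "B = vert ` {..<4}"
  shows "(\<Sum>S\<in>{S. S \<subseteq> B \<and> card S = 2}. a (arc_class S) * b (arc_class (orth_proj ((span S)\<^sup>\<bottom>) ` (B - S))))
    = f edge_length * g dihedral_angle"
proof -
  have dual: "inj_on vert {..<4}" "B \<in> simplices" "span B = UNIV"
    using dual_system_simplex[of vert nrml] vert_norm nrml_vert B by simp_all
  then have ind: "independent B" and card: "card B = 4" and fin: "finite B"
    using independent_imp_finite by (auto simp: simplices_def)
  have Beq: "B = {vert 0, vert 1, vert 2, vert 3}"
    unfolding B by (auto simp: numeral_eq_Suc lessThan_Suc)
  have ne: "vert i \<noteq> vert j" if "i < 4" "j < 4" "i \<noteq> j" for i j
    using dual(1) that by (auto dest: inj_onD)
  \<comment> \<open>The edge that omits \<open>vert 1\<close> and \<open>vert 2\<close>, the only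
    one whose dihedral angle is not pi/2 or pi/4.\<close>
  let ?S = "{vert 0, vert 3}"
  have BS: "B - ?S = {vert 1, vert 2}" unfolding Beq using ne[of 1 0] ne[of 1 3] ne[of 2 0] ne[of 2 3] by auto
  have "(\<Sum>S\<in>{S. S \<subseteq> B \<and> card S = 2}. a (arc_class S) * b (arc_class (orth_proj ((span S)\<^sup>\<bottom>) ` (B - S))))
      = (\<Sum>S\<in>{?S}. a (arc_class S) * b (arc_class (orth_proj ((span S)\<^sup>\<bottom>) ` (B - S))))"
  proof (rule sum.mono_neutral_right)
    show "finite {S. S \<subseteq> B \<and> card S = 2}" using fin by simp
    show "{?S} \<subseteq> {S. S \<subseteq> B \<and> card S = 2}" using Beq ne[of 0 3] by auto
    show "\<forall>S\<in>{S. S \<subseteq> B \<and> card S = 2} - {?S}.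
        a (arc_class S) * b (arc_class (orth_proj ((span S)\<^sup>\<bottom>) ` (B - S))) = 0"
    proof
      fix S assume S: "S \<in> {S. S \<subseteq> B \<and> card S = 2} - {?S}"
      then have "card (B - S) = 2" using card card_Diff_subset[OF finite_subset[OF _ fin], of S] by auto
      then obtain x y where xy: "B - S = {x, y}" "x \<noteq> y" by (auto simp: card_2_iff)
      then have "x \<in> vert ` {..<4}" "y \<in> vert ` {..<4}" using B by blast+
      then obtain i j where ij: "i < 4" "j < 4" "x = vert i" "y = vert j" by auto
      have "{i, j} \<noteq> {1, 2}"
      proof
        assume "{i, j} = {1, 2}"
        then have "B - S = B - ?S" unfolding BS xy(1) ij by (auto simp: doubleton_eq_iff)
        then show False using S Beq by blast
      qed
      then show "a (arc_class S) * b (arc_class (orth_proj ((span S)\<^sup>\<bottom>) ` (B - S))) = 0"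
        using angle_functional_dihedral(2)[OF g b B ij(1,2), of S] xy ij S by auto
    qed
  qed
  also have "\<dots> = a (arc_class ?S) * g dihedral_angle"
    using angle_functional_dihedral(2)[OF g b B, of 1 2 ?S] BS Beq by simp
  also have "a (arc_class ?S) = f edge_length"
  proof -
    have "independent ?S" by (rule independent_mono[OF ind]) (simp add: Beq)
    then obtain u v where uv: "{u, v} \<in> simplices" "arc_class ?S = simplex_class {u, v}"
        "u \<bullet> v = sgn (vert 0) \<bullet> sgn (vert 3)"
      using arc_class_simplex[of "vert 0" "vert 3"] ne[of 0 3] by auto
    have "sgn (vert 0) \<bullet> sgn (vert 3) = 15 / 41"
      using vert_norm[of 0] vert_norm[of 3]
      by (simp add: sgn_div_norm) (simp add: vert_def inner_vector_4)
    then show ?thesis unfolding uv(2) a[OF uv(1)] uv(3) edge_length_def by (rule arg_cong)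
  qed
  finally show ?thesis .
qed

theorem theorem8p1:
  fixes D :: "(real ^ 4) scissors_class \<Rightarrow>
              ((real ^ 2) scissors_class \<times> (real ^ 2) scissors_class \<Rightarrow>\<^sub>0 int) set"
  assumes "is_Dehn_invariant D"
  shows "\<exists>x \<in> carrier scissors_group. (tensor_swap \<circ> D) x \<noteq> D x"
proof -
  obtain f :: "real \<Rightarrow> real" where f: "\<And>x y :: real. f (x + y) = f x + f y" "f pi = 0" "f edge_length = 1" "f dihedral_angle = 0"
    using additive_functional_exists[of 1 0] by blast
  obtain g :: "real \<Rightarrow> real" where g: "\<And>x y :: real. g (x + y) = g x + g y" "g pi = 0" "g edge_length = 0" "g dihedral_angle = 1"
    using additive_functional_exists[of 0 1] by blast
  obtain a where a: "a \<in> hom scissors_group real_add_group"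
      "\<And>u v :: real ^ 2. {u, v} \<in> simplices \<Longrightarrow> a (simplex_class {u, v}) = f (arccos (u \<bullet> v))"
    using angle_functional[OF f(1,2)] by blast
  obtain b where b: "b \<in> hom scissors_group real_add_group"
      "\<And>u v :: real ^ 2. {u, v} \<in> simplices \<Longrightarrow> b (simplex_class {u, v}) = g (arccos (u \<bullet> v))"
    using angle_functional[OF g(1,2)] by blast
  let ?G = "scissors_group :: (real ^ 2) scissors_class monoid"
  have G: "comm_group ?G" by (rule comm_group_scissors_group)
  obtain T where T: "T \<in> hom scissors_S1_tensor_S1 real_add_group"
      "\<And>x y. x \<in> carrier ?G \<Longrightarrow> y \<in> carrier ?G \<Longrightarrow> T (pure_tensor ?G ?G x y) = a x * b y"
    using tensor_product_universal_real[OF G G a(1) b(1)] by blast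
  define B where "B = vert ` {..<4}"
  have dual: "inj_on vert {..<4}" "B \<in> simplices"
    using dual_system_simplex[of vert nrml] vert_norm nrml_vert B_def by simp_all
  have ind: "independent B" and card: "card B = 4" and fin: "finite B"
    using dual(2) independent_imp_finite by (auto simp: simplices_def)
  define A where "A = {S. S \<subseteq> B \<and> card S = 2}"
  define p where "p S = arc_class S" for S :: "(real ^ 4) set"
  define q where "q S = arc_class (orth_proj ((span S)\<^sup>\<bottom>) ` (B - S))" for S
  have p: "p S \<in> carrier ?G" if "S \<in> A" for S
  proof -
    have "independent S" "card S = 2" using that ind independent_mono by (auto simp: A_def)
    then obtain x y where "S = {x, y}" "x \<noteq> y" "independent {x, y}" by (auto simp: card_2_iff)
    then show ?thesis
      using arc_class_simplex[of x y] simplex_class_closed unfolding p_def by metis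
  qed
  have q: "q S \<in> carrier ?G" if "S \<in> A" for S
  proof -
    have "card (B - S) = 2"
      using that card card_Diff_subset[OF finite_subset[OF _ fin], of S] by (auto simp: A_def)
    then obtain x y where xy: "B - S = {x, y}" "x \<noteq> y" by (auto simp: card_2_iff)
    then have "x \<in> vert ` {..<4}" "y \<in> vert ` {..<4}" using B_def by blast+
    then obtain i j where ij: "i < 4" "j < 4" "x = vert i" "y = vert j" by auto
    then show ?thesis
      using angle_functional_dihedral(1)[OF f(1,2) a(2) B_def ij(1,2), of S] xy that
      unfolding q_def by (auto simp: A_def)
  qed
  let ?x = "simplex_class B"
  have Dx: "D ?x = (\<Otimes>\<^bsub>scissors_S1_tensor_S1\<^esub>S\<in>A. pure_tensor ?G ?G (p S) (q S))"
    using assms dual(2) unfolding is_Dehn_invariant_def A_def p_def q_def by blast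
  have finA: "finite A" using fin by (simp add: A_def)
  have closed: "(\<lambda>S. pure_tensor ?G ?G (p S) (q S)) \<in> A \<rightarrow> carrier scissors_S1_tensor_S1"
    using p q by (simp add: pure_tensor_closed)
  interpret TT: comm_group scissors_S1_tensor_S1 by (rule comm_group_tensor_product[OF G G])
  have "T (D ?x) = (\<Sum>S\<in>A. a (p S) * b (q S))"
    unfolding Dx TT.hom_finprod_real_add[OF T(1) finA closed] by (simp add: T(2) p q)
  also have "\<dots> = 1"
    using orthoscheme_sum[OF f(1,2) g(1,2) a(2) b(2) B_def] f g by (simp add: A_def p_def q_def)
  finally have 1: "T (D ?x) = 1" .
  \<comment> \<open>Absorbing the swap into the functional exchanges \<open>a\<close> and
    \<open>b\<close>; the same sum then equals \<open>g edge_length * f dihedral_angle\<close>,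
    which is zero.\<close>
  have swap: "T \<circ> tensor_swap \<in> hom scissors_S1_tensor_S1 real_add_group"
    by (rule hom_compose[OF tensor_swap_hom[OF G G] T(1)])
  have "(T \<circ> tensor_swap) (D ?x) = (\<Sum>S\<in>A. b (p S) * a (q S))"
    unfolding Dx TT.hom_finprod_real_add[OF swap finA closed]
    by (simp add: tensor_swap_pure[OF G G] T(2) p q mult.commute)
  also have "\<dots> = 0"
    using orthoscheme_sum[OF g(1,2) f(1,2) b(2) a(2) B_def] f g by (simp add: A_def p_def q_def)
  finally have "T (tensor_swap (D ?x)) \<noteq> T (D ?x)" using 1 by simp
  then have "(tensor_swap \<circ> D) ?x \<noteq> D ?x" by auto
  then show ?thesis using simplex_class_closed[OF dual(2)] by blast
qed

end
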